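(* The square lattice $\mathbb{Z}^2$ is geodesically directable.
   Context: All graphs are connected and (here) unweighted. $\mathbb{Z}^2$ also denotes the square lattice graph, in which two points of $\mathbb{Z}^2$ are adjacent iff they are at $\ell_1$-distance $1$. $d_X(u,v)$ denotes the graph distance in $X$, and a geodesic is a shortest path. For graphs $X,Y$ on the same vertex set, $X$ is a bounded extension of $Y$ if $Y$ is a subgraph of $X$ and $d_Y(u,v)$ is uniformly bounded over edges $uv$ of $X$. For vertices $u,v$ of a graph $X$ and an integer $k$, the geodesic slice $S_X(u,v,k)$ is the set of vertices $w$ lying on a geodesic between $u$ and $v$ in $X$ with $d_X(u,w)=k$. $X$ has bounded geodesic slices if $|S_X(u,v,k)|$ is uniformly bounded over all vertices $u,v$ and integers $k$. A graph $L$ is geodesically directable if there exists a bounded extension $G$ of $L$ with bounded geodesic slices. *)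

theory Defs
  imports "Graph_Theory.Graph_Theory"
begin

text \<open>
  A simple undirected graph is a \<^typ>\<open>'a pair_pre_digraph\<close> (so without parallel arcs) that has
  no loops and is symmetric: an edge is a pair of opposite arcs. It need not be finite.
  The name \<open>connected\<close> is qualified to avoid the topological constant of the same name.
\<close>

locale connected_graph = pair_bidirected_digraph G
  for G :: "'a pair_pre_digraph" +
  assumes connected: "Digraph_Component.connected (with_proj G)"

definition graph_dist :: "'a pair_pre_digraph \<Rightarrow> 'a \<Rightarrow> 'a \<Rightarrow> ereal" where
  "graph_dist X u v = wf_digraph.\<mu> (with_proj X) (\<lambda>_. 1) u v"

definition geodesic :: "'a pair_pre_digraph \<Rightarrow> 'a \<Rightarrow> ('a \<times> 'a) awalk \<Rightarrow> 'a \<Rightarrow> bool" where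
  "geodesic X u p v \<longleftrightarrow>
     pre_digraph.apath (with_proj X) u p v \<and>
     (\<forall>q. pre_digraph.apath (with_proj X) u q v \<longrightarrow> length p \<le> length q)"

definition geodesic_slice :: "'a pair_pre_digraph \<Rightarrow> 'a \<Rightarrow> 'a \<Rightarrow> int \<Rightarrow> 'a set" where
  "geodesic_slice X u v k =
     {w. (\<exists>p. geodesic X u p v \<and> w \<in> set (pre_digraph.awalk_verts (with_proj X) u p)) \<and>
         graph_dist X u w = ereal (real_of_int k)}"

text \<open>Finiteness is required separately because \<^const>\<open>card\<close> is 0 on infinite sets.\<close>

definition bounded_geodesic_slices :: "'a pair_pre_digraph \<Rightarrow> bool" where
  "bounded_geodesic_slices X \<longleftrightarrow>
     (\<exists>C::nat. \<forall>u \<in> pverts X. \<forall>v \<in> pverts X. \<forall>k::int.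
        finite (geodesic_slice X u v k) \<and> card (geodesic_slice X u v k) \<le> C)"

definition bounded_extension :: "'a pair_pre_digraph \<Rightarrow> 'a pair_pre_digraph \<Rightarrow> bool" where
  "bounded_extension X Y \<longleftrightarrow>
     spanning (with_proj Y) (with_proj X) \<and>
     (\<exists>C::nat. \<forall>(u, v) \<in> parcs X. graph_dist Y u v \<le> ereal (real C))"

definition geodesically_directable :: "'a pair_pre_digraph \<Rightarrow> bool" where
  "geodesically_directable L \<longleftrightarrow>
     (\<exists>G. connected_graph G \<and> bounded_extension G L \<and> bounded_geodesic_slices G)"

definition square_lattice :: "(int \<times> int) pair_pre_digraph" where
  "square_lattice =
     \<lparr> pverts = UNIV, parcs = {((a, b), (c, d)). \<bar>a - c\<bar> + \<bar>b - d\<bar> = 1} \<rparr>"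

lemma connected_graph_square_lattice: "connected_graph square_lattice"
proof -
  let ?Z = "square_lattice"
  let ?R = "(parcs ?Z)\<^sup>*"
  have step: "((a, b), (c, d)) \<in> ?R" if "\<bar>a - c\<bar> + \<bar>b - d\<bar> = 1" for a b c d
    using that by (intro r_into_rtrancl) (simp add: square_lattice_def)
  have right: "((a, b), (a + int n, b)) \<in> ?R" for a b n
  proof (induction n)
    case (Suc n)
    show ?case by (rule rtrancl_trans[OF Suc]) (rule step, simp)
  qed simp
  have up: "((a, b), (a, b + int n)) \<in> ?R" for a b n
  proof (induction n)
    case (Suc n)
    show ?case by (rule rtrancl_trans[OF Suc]) (rule step, simp)
  qed simp
  have "sym (parcs ?Z)"
    by (auto simp: sym_def square_lattice_def abs_minus_commute)
  then have sym: "sym ?R" by (rule sym_rtrancl)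
  have horizontal: "((a, b), (c, b)) \<in> ?R" for a b c
    using right[of a b "nat (c - a)"] symD[OF sym right[of c b "nat (a - c)"]]
    by (cases "a \<le> c") simp_all
  have vertical: "((c, b), (c, d)) \<in> ?R" for b c d
    using up[of c b "nat (d - b)"] symD[OF sym up[of c d "nat (b - d)"]]
    by (cases "b \<le> d") simp_all
  have all: "(u, v) \<in> ?R" for u v
    using rtrancl_trans[OF horizontal vertical] by (metis surj_pair)
  interpret pair_bidirected_digraph ?Z
    by unfold_locales (auto simp: square_lattice_def symmetric_def sym_def abs_minus_commute)
  have "u \<rightarrow>\<^sup>*\<^bsub>with_proj ?Z\<^esub> v" for u v
    using all[of u v] by (simp add: reachable_conv) (simp add: square_lattice_def)
  then have "Digraph_Component.connected (with_proj ?Z)"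
    by (intro connectedI reachable_mk_symmetricI) (simp_all add: square_lattice_def)
  then show ?thesis
    by unfold_locales
qed

end

theory Submission
  imports Defs "HOL-Number_Theory.Cong"
begin

text \<open>
  Give the line \<open>n\<close> of the grid, horizontal or vertical, a level that behaves like the 2-adic
  valuation of \<open>n\<close>, and let a step along a line cost 1, plus 1 whenever it leaves or meets a crossing
  line of higher level. An interval of lines then has a unique line of maximal level, and among its
  lines this one is the cheapest at every step. Hence every geodesic passes through the
  crossing of the best column and the best row that it visits, and on the way there the levels of its
  columns (and of its rows) only increase: it follows lines whose level is at least the
  binary logarithm of the distance travelled, up to a constant. Only boundedly many such lines are near a given starting point. The best
  lines themselves can differ between geodesics with the same endpoints, because a detour to a better
  line may pay off exactly, but not at three well separated levels on the same side.

  The weighted grid sits on the even points of the square lattice: an edge of weight 2 is a pair of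
  lattice edges, and an edge of weight 1 is an added arc of length 2. Long geodesics of the extended
  lattice meet the even points within bounded gaps, so bounded slices carry over.
\<close>

section \<open>Levels\<close>

text \<open>In the unmodified lattice all monotone staircases between two points are geodesics, so a
  slice can be as large as the distance. The surcharges break these ties at all scales although no
  weight exceeds 2: over a distance \<open>D\<close> a line of level \<open>l\<close> is charged
  about \<open>D / 2 ^ l\<close> times, while the lines of level at least \<open>l\<close> are
  \<open>2 ^ l\<close> apart. Changing to a better line that has to be reached anyway costs no extra
  length. Only charges are compared then, and a distance of order \<open>2 ^ l\<close> already
  decides for the better line. A better line off the way is different, since its extra length is
  paid twice: a detour of length of order \<open>2 ^ l'\<close> away from a line of lower level
  \<open>l\<close> pays for itself only at distances of order \<open>2 ^ (l + l')\<close>. Hence the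
  number of best lines needs an argument of its own, in which charges are weighed against
  length.\<close>

text \<open>The factor 3 makes the argument nonzero for every integer, so that all levels are finite.\<close>

definition lev :: "int \<Rightarrow> nat" where
  "lev n = multiplicity 2 (3 * n + 1)"

lemma le_lev_iff: "l \<le> lev n \<longleftrightarrow> (2::int) ^ l dvd 3 * n + 1"
proof -
  have "3 * n + 1 \<noteq> 0" by presburger
  then show ?thesis
    unfolding lev_def by (subst power_dvd_iff_le_multiplicity) auto
qed

lemma coprime_3_power_2: "coprime (3::int) (2 ^ l)"
  by simp

text \<open>Since 3 is invertible modulo \<open>2 ^ l\<close>, the lines of level at least
  \<open>l\<close> form a single residue class modulo \<open>2 ^ l\<close>.\<close>

lemma le_lev_cong:
  assumes "l \<le> lev a"
  shows "l \<le> lev b \<longleftrightarrow> (2::int) ^ l dvd b - a"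
proof -
  have a: "(2::int) ^ l dvd 3 * a + 1" using assms by (simp add: le_lev_iff)
  have "l \<le> lev b \<longleftrightarrow> (2::int) ^ l dvd (3 * b + 1) - (3 * a + 1)"
    using dvd_diff_left_iff[OF a, of "3 * b + 1"] by (simp only: le_lev_iff)
  also have "(3 * b + 1) - (3 * a + 1) = 3 * (b - a)" by simp
  also have "(2::int) ^ l dvd 3 * (b - a) \<longleftrightarrow> 2 ^ l dvd b - a"
    using coprime_dvd_mult_right_iff[of "2 ^ l" 3 "b - a"] coprime_3_power_2[of l]
    by (simp add: coprime_commute)
  finally show ?thesis .
qed

lemma dist_ge_if_lev:
  assumes "l \<le> lev a" "l \<le> lev b" "a \<noteq> b"
  shows "(2::int) ^ l \<le> \<bar>a - b\<bar>"
proof -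
  have "(2::int) ^ l dvd a - b" using assms le_lev_cong by blast
  then show ?thesis using assms(3) dvd_imp_le_int[of "a - b" "2 ^ l"] by simp
qed

lemma not_Suc_lev_dvd: "\<not> (2::int) ^ Suc (lev a) dvd 3 * a + 1"
  using le_lev_iff[of "Suc (lev a)" a] by simp

text \<open>Both \<open>3 * a + 1\<close> and \<open>3 * s\<close> are odd multiples of
  \<open>2 ^ lev a\<close>, so their sum is an even multiple.\<close>

lemma lev_add_gt:
  assumes "\<bar>s\<bar> = 2 ^ lev a"
  shows "lev a < lev (a + s)"
proof -
  have "(2::int) ^ lev a dvd 3 * a + 1" using le_lev_iff by blast
  then obtain k where k: "3 * a + 1 = 2 ^ lev a * k" by (elim dvdE)
  have "odd k" using not_Suc_lev_dvd[of a] k by (auto elim!: evenE)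
  consider "s = 2 ^ lev a" | "s = - (2 ^ lev a)" using assms by linarith
  then have "\<exists>k'. odd k' \<and> 3 * s = 2 ^ lev a * k'"
    by cases (auto intro: exI[of _ "3"] exI[of _ "-3"])
  then obtain k' where k': "odd k'" "3 * s = 2 ^ lev a * k'" by blast
  have "3 * (a + s) + 1 = 2 ^ lev a * (k + k')" using k k'(2) by (simp add: algebra_simps)
  moreover have "even (k + k')" using \<open>odd k\<close> k'(1) by simp
  ultimately have "2 ^ Suc (lev a) dvd 3 * (a + s) + 1"
    by (metis mult_dvd_mono dvd_refl mult.commute power_Suc)
  then show ?thesis using le_lev_iff[of "Suc (lev a)" "a + s"] by simp
qed

lemma lev_add_eq:
  assumes "l < lev a" "\<bar>s\<bar> = 2 ^ l"
  shows "lev (a + s) = l"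
proof -
  have "(2::int) ^ l dvd s" using assms(2) by (metis dvd_abs_iff dvd_refl)
  then have "l \<le> lev (a + s)" using assms by (subst le_lev_cong[of l a]) auto
  moreover have "\<not> Suc l \<le> lev (a + s)"
  proof
    assume "Suc l \<le> lev (a + s)"
    then have *: "(2::int) ^ Suc l dvd s"
      using le_lev_cong[of "Suc l" a "a + s"] assms(1) by simp
    have "s \<noteq> 0" using assms(2) by auto
    from dvd_imp_le_int[OF this *] show False using assms(2) by simp
  qed
  ultimately show ?thesis by simp
qed

lemma ex_lev_ge: "\<exists>n. a \<le> n \<and> n < a + 2 ^ l \<and> l \<le> lev n"
proof -
  obtain x :: int where x: "[3 * x = 1] (mod 2 ^ l)"
    using cong_solve_coprime_int[OF coprime_3_power_2] by blast
  have "l \<le> lev (- x)"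
    using x by (simp add: le_lev_iff cong_iff_dvd_diff dvd_diff_commute)
  define n where "n = a + (- x - a) mod 2 ^ l"
  have "(2::int) ^ l dvd n - (- x)"
    using dvd_minus_mod[of "2 ^ l" "- x - a"] dvd_diff_commute[of "2 ^ l" n "- x"]
    unfolding n_def by (simp only: diff_diff_eq2 diff_diff_add)
  then have "l \<le> lev n" using le_lev_cong[OF \<open>l \<le> lev (- x)\<close>] by blast
  then show ?thesis by (intro exI[of _ n]) (simp add: n_def)
qed

lemma ex_lev_eq: "\<exists>n. a \<le> n \<and> n < a + 2 * 2 ^ l \<and> lev n = l"
proof -
  obtain n where n: "a \<le> n" "n < a + 2 ^ l" "l \<le> lev n" using ex_lev_ge by blast
  show ?thesis
  proof (cases "lev n = l")
    case True
    then show ?thesis using n by (intro exI[of _ n]) auto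
  next
    case False
    then have "lev (n + 2 ^ l) = l" using n by (intro lev_add_eq) auto
    then show ?thesis using n by (intro exI[of _ "n + 2 ^ l"]) auto
  qed
qed

text \<open>This makes the line of maximal level in an interval unique. The witness is one period
  \<open>2 ^ lev a\<close> above the smaller line.\<close>

lemma lev_between:
  assumes "lev a = lev b" "a \<noteq> b"
  obtains z where "min a b < z" "z < max a b" "lev a < lev z"
proof -
  let ?z = "min a b + 2 ^ lev a"
  have lev: "lev a < lev ?z"
    using lev_add_gt[of "2 ^ lev a" a] lev_add_gt[of "2 ^ lev a" b] assms(1) by (simp add: min_def)
  have "(2::int) ^ lev a \<le> \<bar>a - b\<bar>" using assms by (intro dist_ge_if_lev) auto
  then have "?z \<le> max a b" by linarith
  moreover have "?z \<noteq> max a b" using lev assms(1) by (auto simp: max_def)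
  ultimately show ?thesis using lev by (intro that[of ?z]) auto
qed

text \<open>The numbers \<open>3 * n + 1\<close> and \<open>3 * n + 4\<close> have opposite parity.
  Hence at most one end of an edge can be the reason for a charge.\<close>

lemma lev_adjacent: "lev n = 0 \<longleftrightarrow> 0 < lev (n + 1)"
  using le_lev_iff[of 1 n] le_lev_iff[of 1 "n + 1"] by auto

lemma not_both_lev: "\<lbrakk>Suc l \<le> lev n; Suc l \<le> lev (n + 1)\<rbrakk> \<Longrightarrow> False"
  using lev_adjacent[of n] by linarith

section \<open>Counting the lines of high level in an interval\<close>

lemma finite_Collect_interval: "finite {e \<in> {a..<b::int}. P e}"
  by (rule finite_subset[of _ "{a..<b}"]) auto

lemma card_split_interval:
  fixes a b c :: int
  assumes "a \<le> b" "b \<le> c"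
  shows "card {e \<in> {a..<c}. P e} = card {e \<in> {a..<b}. P e} + card {e \<in> {b..<c}. P e}"
proof -
  have *: "{e \<in> {a..<c}. P e} = {e \<in> {a..<b}. P e} \<union> {e \<in> {b..<c}. P e}"
    using assms by auto
  show ?thesis
    unfolding * by (intro card_Un_disjoint finite_Collect_interval) auto
qed

definition lev_count :: "nat \<Rightarrow> int \<Rightarrow> int \<Rightarrow> nat" where
  "lev_count l a b = card {n \<in> {a..<b}. l \<le> lev n}"

lemma lev_count_window: "lev_count l a (a + 2 ^ l) = 1"
proof -
  obtain n where n: "a \<le> n" "n < a + 2 ^ l" "l \<le> lev n" using ex_lev_ge by blast
  have *: "m = n" if "a \<le> m" "m < a + 2 ^ l" "l \<le> lev m" for m
    using dist_ge_if_lev[of l m n] that n by linarith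
  have "{n \<in> {a..<a + 2 ^ l}. l \<le> lev n} = {n}"
  proof (intro equalityI subsetI)
    fix m assume "m \<in> {n \<in> {a..<a + 2 ^ l}. l \<le> lev n}"
    then show "m \<in> {n}" using *[of m] by simp
  qed (use n in simp)
  then show ?thesis by (simp add: lev_count_def)
qed

lemma lev_count_add: "\<lbrakk>a \<le> b; b \<le> c\<rbrakk> \<Longrightarrow> lev_count l a c = lev_count l a b + lev_count l b c"
  unfolding lev_count_def by (rule card_split_interval)

lemma lev_count_windows: "lev_count l a (a + int N * 2 ^ l) = N"
proof (induction N)
  case (Suc N)
  have "lev_count l a (a + int (Suc N) * 2 ^ l) = lev_count l a (a + int N * 2 ^ l)
      + lev_count l (a + int N * 2 ^ l) (a + int N * 2 ^ l + 2 ^ l)"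
    by (subst lev_count_add[of a "a + int N * 2 ^ l"]) (auto simp: algebra_simps)
  then show ?case by (simp only: Suc lev_count_window)
qed (simp add: lev_count_def)

lemma lev_count_mono: "b \<le> c \<Longrightarrow> lev_count l a b \<le> lev_count l a c"
  unfolding lev_count_def by (intro card_mono finite_Collect_interval) auto

lemma lev_count_ge:
  assumes "a + int N * 2 ^ l \<le> b"
  shows "N \<le> lev_count l a b"
  using lev_count_mono[OF assms, of l a] by (simp add: lev_count_windows)

lemma lev_count_le:
  assumes "b \<le> a + int N * 2 ^ l"
  shows "lev_count l a b \<le> N"
  using lev_count_mono[OF assms, of l a] by (simp add: lev_count_windows)

section \<open>The cost of a straight run along a line\<close>

definition edge_lev :: "int \<Rightarrow> nat" where
  "edge_lev x = max (lev x) (lev (x + 1))"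

text \<open>The integer \<open>e\<close> stands for the unit edge from \<open>e\<close> to
  \<open>e + 1\<close>. The result is the number of surcharges on a line of level
  \<open>l\<close>.\<close>

definition edge_count :: "nat \<Rightarrow> int \<Rightarrow> int \<Rightarrow> nat" where
  "edge_count l a b = card {e \<in> {min a b..<max a b}. l < edge_lev e}"

definition line_cost :: "nat \<Rightarrow> int \<Rightarrow> int \<Rightarrow> nat" where
  "line_cost l a b = nat \<bar>a - b\<bar> + edge_count l a b"

lemma edge_count_commute: "edge_count l a b = edge_count l b a"
  by (simp add: edge_count_def min.commute max.commute)

lemma line_cost_commute: "line_cost l a b = line_cost l b a"
  by (simp add: line_cost_def edge_count_commute abs_minus_commute)

lemma line_cost_refl [simp]: "line_cost l a a = 0"
  by (simp add: line_cost_def edge_count_def)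

lemma edge_count_triangle: "edge_count l a c \<le> edge_count l a b + edge_count l b c"
proof -
  have "{e \<in> {min a c..<max a c}. l < edge_lev e} \<subseteq>
     {e \<in> {min a b..<max a b}. l < edge_lev e} \<union> {e \<in> {min b c..<max b c}. l < edge_lev e}"
    by auto
  then show ?thesis unfolding edge_count_def
    by (intro order.trans[OF card_mono card_Un_le] finite_UnI finite_Collect_interval)
qed

lemma line_cost_triangle: "line_cost l a c \<le> line_cost l a b + line_cost l b c"
  using edge_count_triangle[of l a c b] unfolding line_cost_def by linarith

lemma edge_count_add: "\<lbrakk>a \<le> b; b \<le> c\<rbrakk> \<Longrightarrow> edge_count l a c = edge_count l a b + edge_count l b c"
  using card_split_interval[of a b c "\<lambda>e. l < edge_lev e"] by (simp add: edge_count_def)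

lemma edge_count_antimono: "l \<le> l' \<Longrightarrow> edge_count l' a b \<le> edge_count l a b"
  unfolding edge_count_def by (intro card_mono finite_Collect_interval) auto

lemma line_cost_antimono: "l \<le> l' \<Longrightarrow> line_cost l' a b \<le> line_cost l a b"
  using edge_count_antimono[of l l' a b] by (simp add: line_cost_def)

lemma line_cost_ge: "\<bar>a - b\<bar> \<le> int (line_cost l a b)"
  by (simp add: line_cost_def)

lemma edge_count_le_abs: "edge_count l a b \<le> nat \<bar>a - b\<bar>"
proof -
  have "edge_count l a b \<le> card {min a b..<max a b}" unfolding edge_count_def by (intro card_mono) auto
  also have "\<dots> = nat \<bar>a - b\<bar>" by (simp add: min_def max_def)
  finally show ?thesis .
qed

lemma line_cost_le: "int (line_cost l a b) \<le> 2 * \<bar>a - b\<bar>"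
  using edge_count_le_abs[of l a b] unfolding line_cost_def by simp

lemma edge_count_unit: "edge_count l x (x + 1) = of_bool (l < edge_lev x)"
proof -
  have "{e \<in> {x..<x + 1}. l < edge_lev e} = (if l < edge_lev x then {x} else {})"
    by auto
  then show ?thesis by (simp add: edge_count_def min_def max_def)
qed

text \<open>Exactly one end of a charged edge is responsible for the charge. Left and right ends are
  counted separately, in two intervals that differ by a shift of one.\<close>

lemma edge_count_eq_cnt:
  assumes "a \<le> b"
  shows "edge_count l a b = lev_count (Suc l) a b + lev_count (Suc l) (a + 1) (b + 1)"
proof -
  let ?A = "{e \<in> {a..<b}. Suc l \<le> lev e}" and ?B = "{e \<in> {a..<b}. Suc l \<le> lev (e + 1)}"
  have "{e \<in> {a..<b}. l < edge_lev e} = ?A \<union> ?B"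
    by (auto simp: edge_lev_def)
  moreover have "?A \<inter> ?B = {}"
  proof -
    have False if "e \<in> ?A" "e \<in> ?B" for e
      using that not_both_lev[of l e] by simp
    then show ?thesis by blast
  qed
  moreover have "card ?B = lev_count (Suc l) (a + 1) (b + 1)"
    unfolding lev_count_def
    by (intro bij_betw_same_card[of "\<lambda>e. e + 1"] bij_betwI[where g = "\<lambda>e. e - 1"]) auto
  moreover have "card (?A \<union> ?B) = card ?A + card ?B"
    using \<open>?A \<inter> ?B = {}\<close> by (intro card_Un_disjoint finite_Collect_interval)
  ultimately show ?thesis
    using assms by (simp add: edge_count_def lev_count_def min_absorb1 max_absorb2)
qed

lemma edge_count_ge:
  assumes "int N * 2 ^ Suc l \<le> \<bar>a - b\<bar>"
  shows "2 * N \<le> edge_count l a b"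
proof -
  have *: "2 * N \<le> edge_count l a b" if "a + int N * 2 ^ Suc l \<le> b" "a \<le> b" for a b
    using lev_count_ge[of a N "Suc l" b] lev_count_ge[of "a + 1" N "Suc l" "b + 1"] that
    by (simp add: edge_count_eq_cnt)
  show ?thesis
    using *[of a b] *[of b a] assms by (cases "a \<le> b") (auto simp: edge_count_commute)
qed

lemma edge_count_le:
  assumes "\<bar>a - b\<bar> \<le> int N * 2 ^ Suc l"
  shows "edge_count l a b \<le> 2 * N"
proof -
  have *: "edge_count l a b \<le> 2 * N" if "b \<le> a + int N * 2 ^ Suc l" "a \<le> b" for a b
    using lev_count_le[of b a N "Suc l"] lev_count_le[of "b + 1" "a + 1" N "Suc l"] that
    by (simp add: edge_count_eq_cnt)
  show ?thesis
    using *[of b a] *[of a b] assms by (cases "a \<le> b") (auto simp: edge_count_commute)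
qed

text \<open>Every full period \<open>2 ^ Suc l\<close> contains exactly two charged edges. Together
  with \<open>edge_count_upper\<close> this says that the number of charges is
  \<open>\<bar>a - b\<bar> / 2 ^ l\<close> up to an error of 2.\<close>

lemma edge_count_lower: "2 ^ l * (int (edge_count l a b) + 2) \<ge> \<bar>a - b\<bar>"
proof -
  define q :: int where "q = 2 ^ Suc l"
  define N where "N = nat (\<bar>a - b\<bar> div q)"
  have q: "q > 0" by (simp add: q_def)
  have N: "int N = \<bar>a - b\<bar> div q" using q by (simp add: N_def pos_imp_zdiv_nonneg_iff)
  have "int N * q \<le> \<bar>a - b\<bar>" "\<bar>a - b\<bar> < (int N + 1) * q"
    using div_mult_mod_eq[of "\<bar>a - b\<bar>" q] pos_mod_bound[OF q, of "\<bar>a - b\<bar>"]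
      pos_mod_sign[OF q, of "\<bar>a - b\<bar>"] unfolding N distrib_right mult_1 by linarith+
  then have "2 * N \<le> edge_count l a b" unfolding q_def by (intro edge_count_ge) simp
  then have "(int N + 1) * q \<le> 2 ^ l * (int (edge_count l a b) + 2)"
    unfolding q_def by (simp add: algebra_simps) 
  then show ?thesis using \<open>\<bar>a - b\<bar> < (int N + 1) * q\<close> by linarith
qed

lemma edge_count_upper: "2 ^ l * (int (edge_count l a b) - 2) \<le> \<bar>a - b\<bar>"
proof -
  define q :: int where "q = 2 ^ Suc l"
  define N where "N = nat (\<bar>a - b\<bar> div q)"
  have q: "q > 0" by (simp add: q_def)
  have N: "int N = \<bar>a - b\<bar> div q" using q by (simp add: N_def pos_imp_zdiv_nonneg_iff)
  have N_le: "int N * q \<le> \<bar>a - b\<bar>" and "\<bar>a - b\<bar> < (int N + 1) * q"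
    using div_mult_mod_eq[of "\<bar>a - b\<bar>" q] pos_mod_bound[OF q, of "\<bar>a - b\<bar>"]
      pos_mod_sign[OF q, of "\<bar>a - b\<bar>"] unfolding N distrib_right mult_1 by linarith+
  then have "\<bar>a - b\<bar> \<le> int (Suc N) * q" by (simp add: add.commute)
  then have "edge_count l a b \<le> 2 * Suc N" unfolding q_def by (rule edge_count_le)
  then have "int (edge_count l a b) - 2 \<le> 2 * int N" by simp
  then have "2 ^ l * (int (edge_count l a b) - 2) \<le> 2 ^ l * (2 * int N)"
    by (intro mult_left_mono) auto
  then show ?thesis using N_le by (simp add: q_def algebra_simps)
qed

lemma edge_count_strict:
  assumes "min a b \<le> e" "e < max a b" "edge_lev e = Suc l"
  shows "edge_count (Suc l) a b < edge_count l a b"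
  unfolding edge_count_def
proof (rule psubset_card_mono)
  show "{e \<in> {min a b..<max a b}. Suc l < edge_lev e} \<subset> {e \<in> {min a b..<max a b}. l < edge_lev e}"
  proof
    show "{e \<in> {min a b..<max a b}. Suc l < edge_lev e} \<noteq> {e \<in> {min a b..<max a b}. l < edge_lev e}"
      using assms by (metis (mono_tags, lifting) atLeastLessThan_iff lessI mem_Collect_eq order_less_irrefl)
  qed auto
qed (rule finite_Collect_interval)

lemma edge_lev_left: "0 < lev n \<Longrightarrow> edge_lev n = lev n"
  using lev_adjacent[of n] by (auto simp: edge_lev_def)

lemma edge_lev_right: "0 < lev n \<Longrightarrow> edge_lev (n - 1) = lev n"
  using lev_adjacent[of "n - 1"] by (auto simp: edge_lev_def)

text \<open>The two edges that meet at \<open>z\<close> have level exactly \<open>Suc l\<close>, so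
  they are charged at level \<open>l\<close> but not at level \<open>Suc l\<close>.\<close>

lemma edge_count_inside:
  assumes "min a b < z" "z < max a b" "lev z = Suc l"
  shows "edge_count (Suc l) a b + 2 \<le> edge_count l a b"
proof -
  have "edge_count (Suc l) a b < edge_count l a b" if "min a b \<le> e" "e < max a b" "edge_lev e = Suc l" for a b e
    using edge_count_strict that by blast
  from this[of "min a b" z "z - 1"] this[of z "max a b" z]
  have "edge_count (Suc l) (min a b) z < edge_count l (min a b) z" "edge_count (Suc l) z (max a b) < edge_count l z (max a b)"
    using assms edge_lev_left[of z] edge_lev_right[of z] by auto
  moreover have "edge_count j a b = edge_count j (min a b) z + edge_count j z (max a b)" for j
    using assms edge_count_add[of "min a b" z "max a b" j] by (auto simp: min_def max_def edge_count_commute split: if_splits)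
  ultimately show ?thesis by simp
qed

lemma line_cost_inside:
  assumes "min a b < z" "z < max a b" "lev z = Suc l"
  shows "line_cost (Suc l) a b + 2 \<le> line_cost l a b"
  using edge_count_inside[OF assms] by (simp add: line_cost_def)

text \<open>Only the edge that touches \<open>b\<close> can have a level above
  \<open>l\<close>.\<close>

lemma edge_count_le_one:
  assumes "\<And>z. min a b \<le> z \<Longrightarrow> z \<le> max a b \<Longrightarrow> z \<noteq> b \<Longrightarrow> lev z \<le> l"
  shows "edge_count l a b \<le> 1"
proof -
  have *: "e = (if a \<le> b then b - 1 else b)" if "min a b \<le> e" "e < max a b" "l < edge_lev e" for e
  proof (rule ccontr)
    assume "e \<noteq> (if a \<le> b then b - 1 else b)"
    then have "lev e \<le> l" "lev (e + 1) \<le> l"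
      using that(1,2) by (auto intro!: assms split: if_splits)
    then show False using that(3) by (simp add: edge_lev_def)
  qed
  have "{e \<in> {min a b..<max a b}. l < edge_lev e} \<subseteq> {if a \<le> b then b - 1 else b}"
  proof
    fix e assume "e \<in> {e \<in> {min a b..<max a b}. l < edge_lev e}"
    then show "e \<in> {if a \<le> b then b - 1 else b}" using *[of e] by simp
  qed
  then have "edge_count l a b \<le> card {if a \<le> b then b - 1 else b}"
    unfolding edge_count_def by (rule card_mono[rotated]) simp
  then show ?thesis by simp
qed

section \<open>The weighted grid\<close>

definition gadj :: "int \<times> int \<Rightarrow> int \<times> int \<Rightarrow> bool" where
  "gadj p q \<longleftrightarrow> \<bar>fst p - fst q\<bar> + \<bar>snd p - snd q\<bar> = 1"

definition edge_weight :: "int \<times> int \<Rightarrow> int \<times> int \<Rightarrow> nat" where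
  "edge_weight p q = (if snd p = snd q then line_cost (lev (snd p)) (fst p) (fst q)
             else line_cost (lev (fst p)) (snd p) (snd q))"

lemma gadj_commute: "gadj p q \<longleftrightarrow> gadj q p"
  by (simp add: gadj_def abs_minus_commute)

lemma gadj_cases:
  assumes "gadj p q"
  obtains (H) "snd p = snd q" "\<bar>fst p - fst q\<bar> = 1" | (V) "fst p = fst q" "\<bar>snd p - snd q\<bar> = 1"
  using assms unfolding gadj_def by fastforce

lemma gadj_neq: "gadj p q \<Longrightarrow> p \<noteq> q"
  by (auto simp: gadj_def)

lemma edge_weight_commute: "gadj p q \<Longrightarrow> edge_weight p q = edge_weight q p"
  by (elim gadj_cases) (auto simp: edge_weight_def line_cost_commute)

lemma gadj_swap: "gadj (prod.swap p) (prod.swap q) \<longleftrightarrow> gadj p q"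
  by (simp add: gadj_def add.commute)

lemma edge_weight_swap: "gadj p q \<Longrightarrow> edge_weight (prod.swap p) (prod.swap q) = edge_weight p q"
  by (auto simp: edge_weight_def gadj_def)

lemma edge_weight_H: "snd p = snd q \<Longrightarrow> edge_weight p q = line_cost (lev (snd p)) (fst p) (fst q)"
  by (simp add: edge_weight_def)

lemma edge_weight_V: "gadj p q \<Longrightarrow> fst p = fst q \<Longrightarrow> edge_weight p q = line_cost (lev (fst p)) (snd p) (snd q)"
  by (auto simp: edge_weight_def gadj_def)

inductive wwalk :: "int \<times> int \<Rightarrow> nat \<Rightarrow> int \<times> int \<Rightarrow> bool" for a where
  refl: "wwalk a 0 a"
| step: "wwalk a n b \<Longrightarrow> gadj b c \<Longrightarrow> wwalk a (n + edge_weight b c) c"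

lemma wwalk_trans: "wwalk b n c \<Longrightarrow> wwalk a k b \<Longrightarrow> wwalk a (k + n) c"
  by (induction rule: wwalk.induct) (auto simp flip: add.assoc intro: wwalk.step)

lemma wwalk_sym: "wwalk a n b \<Longrightarrow> wwalk b n a"
proof (induction rule: wwalk.induct)
  case (step n b c)
  have "wwalk c (0 + edge_weight c b) b" using step.hyps(2) by (intro wwalk.step wwalk.refl) (simp add: gadj_commute)
  from wwalk_trans[OF step.IH this] show ?case
    using edge_weight_commute[OF step.hyps(2)] by (simp only: add_0 add.commute)
qed (rule wwalk.refl)

lemma wwalk_swap: "wwalk a n b \<Longrightarrow> wwalk (prod.swap a) n (prod.swap b)"
proof (induction rule: wwalk.induct)
  case (step n b c)
  then show ?case
    using wwalk.step[of "prod.swap a" n "prod.swap b" "prod.swap c"] by (simp add: edge_weight_swap gadj_swap)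
qed (rule wwalk.refl)

lemma wwalk_row: "wwalk (x, y) (line_cost (lev y) x x') (x', y)"
proof -
  have right: "wwalk (x, y) (line_cost (lev y) x (x + int n)) (x + int n, y)" for x n
  proof (induction n)
    case (Suc n)
    have "wwalk (x, y) (line_cost (lev y) x (x + int n) + edge_weight (x + int n, y) (x + int n + 1, y)) (x + int n + 1, y)"
      by (intro wwalk.step Suc) (simp add: gadj_def)
    moreover have "line_cost (lev y) x (x + int n) + edge_weight (x + int n, y) (x + int n + 1, y) = line_cost (lev y) x (x + int n + 1)"
      using edge_count_add[of x "x + int n" "x + int n + 1" "lev y"] by (simp add: edge_weight_def line_cost_def)
    ultimately show ?case by (simp add: algebra_simps)
  qed (simp add: wwalk.refl)
  show ?thesis
  proof (cases "x \<le> x'")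
    case True
    then show ?thesis using right[of x "nat (x' - x)"] by simp
  next
    case False
    then show ?thesis using wwalk_sym[OF right[of x' "nat (x - x')"]] by (simp add: line_cost_commute)
  qed
qed

lemma wwalk_col: "wwalk (x, y) (line_cost (lev x) y y') (x, y')"
  using wwalk_swap[OF wwalk_row[of y x y']] by simp

definition wdist :: "int \<times> int \<Rightarrow> int \<times> int \<Rightarrow> nat" where
  "wdist a b = (LEAST n. wwalk a n b)"

lemma wwalk_ex: "\<exists>n. wwalk a n b"
proof -
  have "wwalk (fst a, snd a) (line_cost (lev (snd a)) (fst a) (fst b)) (fst b, snd a)" by (rule wwalk_row)
  from wwalk_trans[OF wwalk_col this] show ?thesis by (metis prod.collapse)
qed

lemma wwalk_wdist: "wwalk a (wdist a b) b"
  unfolding wdist_def using LeastI_ex[OF wwalk_ex] .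

lemma wdist_le: "wwalk a n b \<Longrightarrow> wdist a b \<le> n"
  unfolding wdist_def by (rule Least_le)

lemma wdist_refl [simp]: "wdist a a = 0"
  using wdist_le[OF wwalk.refl] by simp

lemma wdist_commute: "wdist a b = wdist b a"
  using wdist_le[OF wwalk_sym[OF wwalk_wdist[of a b]]] wdist_le[OF wwalk_sym[OF wwalk_wdist[of b a]]] by simp

lemma wdist_triangle: "wdist a c \<le> wdist a b + wdist b c"
  by (rule wdist_le[OF wwalk_trans[OF wwalk_wdist wwalk_wdist]])

lemma wdist_swap: "wdist (prod.swap a) (prod.swap b) = wdist a b"
  using wdist_le[OF wwalk_swap[OF wwalk_wdist[of a b]]] wdist_le[OF wwalk_swap[OF wwalk_wdist[of "prod.swap a" "prod.swap b"]]]
  by simp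

lemma wdist_row: "wdist (x, y) (x', y) \<le> line_cost (lev y) x x'"
  by (rule wdist_le[OF wwalk_row])

lemma wdist_col: "wdist (x, y) (x, y') \<le> line_cost (lev x) y y'"
  by (rule wdist_le[OF wwalk_col])

lemma wwalk_ge: "wwalk a n b \<Longrightarrow> \<bar>fst a - fst b\<bar> + \<bar>snd a - snd b\<bar> \<le> int n"
proof (induction rule: wwalk.induct)
  case (step n b c)
  have "\<bar>fst b - fst c\<bar> + \<bar>snd b - snd c\<bar> \<le> int (edge_weight b c)"
    using step.hyps(2)
  proof (cases rule: gadj_cases)
    case H
    then show ?thesis using line_cost_ge[of "fst b" "fst c"] by (simp only: edge_weight_H) simp
  next
    case V
    then show ?thesis using line_cost_ge[of "snd b" "snd c"] step.hyps(2) by (simp only: edge_weight_V) simp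
  qed
  then show ?case using step.IH by simp
qed simp

lemma wdist_ge: "\<bar>fst a - fst b\<bar> + \<bar>snd a - snd b\<bar> \<le> int (wdist a b)"
  by (rule wwalk_ge[OF wwalk_wdist])

lemma wdist_le_twice: "int (wdist a b) \<le> 2 * (\<bar>fst a - fst b\<bar> + \<bar>snd a - snd b\<bar>)"
proof -
  have "wdist a b \<le> line_cost (lev (snd a)) (fst a) (fst b) + line_cost (lev (fst b)) (snd a) (snd b)"
    using wdist_triangle[of a b "(fst b, snd a)"] wdist_row[of "fst a" "snd a" "fst b"] wdist_col[of "fst b" "snd a" "snd b"]
    by simp
  then have "int (wdist a b) \<le> int (line_cost (lev (snd a)) (fst a) (fst b)) + int (line_cost (lev (fst b)) (snd a) (snd b))"
    by (metis of_nat_add of_nat_mono)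
  also have "\<dots> \<le> 2 * \<bar>fst a - fst b\<bar> + 2 * \<bar>snd a - snd b\<bar>"
    by (intro add_mono line_cost_le)
  finally show ?thesis by simp
qed

section \<open>Geodesics of the weighted grid as indexed sequences of vertices\<close>

definition path :: "(nat \<Rightarrow> int \<times> int) \<Rightarrow> nat \<Rightarrow> bool" where
  "path p m \<longleftrightarrow> (\<forall>i<m. gadj (p i) (p (Suc i)))"

definition path_cost :: "(nat \<Rightarrow> int \<times> int) \<Rightarrow> nat \<Rightarrow> nat \<Rightarrow> nat" where
  "path_cost p i j = (\<Sum>k\<in>{i..<j}. edge_weight (p k) (p (Suc k)))"

definition geod :: "(nat \<Rightarrow> int \<times> int) \<Rightarrow> nat \<Rightarrow> bool" where
  "geod p m \<longleftrightarrow> path p m \<and> (\<forall>i j. i \<le> j \<longrightarrow> j \<le> m \<longrightarrow> path_cost p i j = wdist (p i) (p j))"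

lemma path_cost_Suc: "i \<le> j \<Longrightarrow> path_cost p i (Suc j) = path_cost p i j + edge_weight (p j) (p (Suc j))"
  by (simp add: path_cost_def)

lemma path_cost_refl [simp]: "path_cost p i i = 0"
  by (simp add: path_cost_def)

lemma path_cost_add: "\<lbrakk>i \<le> j; j \<le> k\<rbrakk> \<Longrightarrow> path_cost p i j + path_cost p j k = path_cost p i k"
  unfolding path_cost_def by (rule sum.atLeastLessThan_concat)

lemma wdist_le_cost: "\<lbrakk>path p m; i \<le> j; j \<le> m\<rbrakk> \<Longrightarrow> wdist (p i) (p j) \<le> path_cost p i j"
proof (rule wdist_le, induction j)
  case (Suc j)
  then show ?case
    by (cases "i = Suc j") (auto simp: path_cost_Suc path_def intro: wwalk.intros)
qed (simp add: wwalk.refl)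

lemma geod_I:
  assumes "path p m" "path_cost p 0 m \<le> wdist (p 0) (p m)"
  shows "geod p m"
  unfolding geod_def
proof (intro conjI allI impI)
  fix i j assume ij: "i \<le> j" "j \<le> m"
  have "path_cost p 0 i + path_cost p i j + path_cost p j m = path_cost p 0 m"
    using ij by (simp add: path_cost_add)
  moreover have "wdist (p 0) (p m) \<le> wdist (p 0) (p i) + wdist (p i) (p j) + wdist (p j) (p m)"
    using wdist_triangle[of "p 0" "p m" "p i"] wdist_triangle[of "p i" "p m" "p j"] by linarith
  moreover have "wdist (p 0) (p i) \<le> path_cost p 0 i" "wdist (p i) (p j) \<le> path_cost p i j" "wdist (p j) (p m) \<le> path_cost p j m"
    using wdist_le_cost[OF assms(1)] ij by auto
  ultimately show "path_cost p i j = wdist (p i) (p j)" using assms(2) by linarith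
qed (rule assms)

lemma path_extend:
  assumes "wwalk w n b" "path p t" "p t = w"
  shows "\<exists>q m. t \<le> m \<and> (\<forall>i\<le>t. q i = p i) \<and> path q m \<and> q m = b \<and> path_cost q 0 m = path_cost p 0 t + n"
  using assms
proof (induction rule: wwalk.induct)
  case refl
  then show ?case by (intro exI[of _ p] exI[of _ t]) simp
next
  case (step n b c)
  then obtain q m where q: "t \<le> m" "\<forall>i\<le>t. q i = p i" "path q m" "q m = b" "path_cost q 0 m = path_cost p 0 t + n"
    by blast
  define q' where "q' = q(Suc m := c)"
  have q': "q' (Suc m) = c" "q' i = q i" if "i \<le> m" for i using that by (auto simp: q'_def)
  have "path_cost q' 0 m = path_cost q 0 m" unfolding path_cost_def by (intro sum.cong) (auto simp: q')
  then have "path_cost q' 0 (Suc m) = path_cost p 0 t + (n + edge_weight b c)" using q by (simp add: path_cost_Suc q')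
  moreover have "path q' (Suc m)" using q step.hyps(2) by (auto simp: path_def less_Suc_eq q')
  ultimately show ?case using q q' by (intro exI[of _ q'] exI[of _ "Suc m"]) auto
qed

text \<open>This turns membership in a slice, which is a condition on distances, into a geodesic
  with a marked vertex.\<close>

lemma ex_geod_through:
  assumes "wdist u w + wdist w v = wdist u v"
  obtains p m t where "geod p m" "p 0 = u" "p m = v" "t \<le> m" "p t = w"
proof -
  obtain q t where q: "path q t" "q 0 = u" "q t = w" "path_cost q 0 t = wdist u w"
    using path_extend[OF wwalk_wdist[of u w], of "\<lambda>_. u" 0] by (auto simp: path_def)
  obtain p m where p: "t \<le> m" "\<forall>i\<le>t. p i = q i" "path p m" "p m = v" "path_cost p 0 m = path_cost q 0 t + wdist w v"
    using path_extend[OF wwalk_wdist[of w v], of q t] q by auto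
  have "geod p m" using p q assms by (intro geod_I) auto
  with p q show ?thesis by (intro that[of p m t]) auto
qed

lemma geod_path: "geod p m \<Longrightarrow> path p m"
  by (simp add: geod_def)

lemma geod_path_cost: "\<lbrakk>geod p m; i \<le> j; j \<le> m\<rbrakk> \<Longrightarrow> path_cost p i j = wdist (p i) (p j)"
  by (simp add: geod_def)

lemma geod_wdist_add: "\<lbrakk>geod p m; i \<le> j; j \<le> k; k \<le> m\<rbrakk> \<Longrightarrow> wdist (p i) (p j) + wdist (p j) (p k) = wdist (p i) (p k)"
  using path_cost_add[of i j k p] by (simp add: geod_path_cost)

lemma geod_swap: "geod p m \<Longrightarrow> geod (prod.swap \<circ> p) m"
proof (rule geod_I)
  assume g: "geod p m"
  show "path (prod.swap \<circ> p) m" using geod_path[OF g] by (simp add: path_def gadj_swap)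
  have "path_cost (prod.swap \<circ> p) 0 m = path_cost p 0 m"
    unfolding path_cost_def using geod_path[OF g] by (intro sum.cong) (auto simp: path_def edge_weight_swap)
  then show "path_cost (prod.swap \<circ> p) 0 m \<le> wdist ((prod.swap \<circ> p) 0) ((prod.swap \<circ> p) m)"
    using g by (simp add: geod_path_cost wdist_swap)
qed

lemma geod_rev: "geod p m \<Longrightarrow> geod (\<lambda>i. p (m - i)) m"
proof (rule geod_I)
  assume g: "geod p m"
  have adj: "gadj (p (m - i)) (p (m - Suc i))" if "i < m" for i
    using geod_path[OF g] that unfolding path_def
    by (metis Suc_diff_Suc diff_less gadj_commute le_less_trans less_nat_zero_code not_gr_zero zero_less_Suc zero_le)
  then show "path (\<lambda>i. p (m - i)) m" by (simp add: path_def)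
  have "path_cost (\<lambda>i. p (m - i)) 0 m = (\<Sum>i<m. edge_weight (p (m - Suc i)) (p (m - i)))"
    unfolding path_cost_def by (intro sum.cong) (auto intro!: edge_weight_commute adj)
  also have "\<dots> = (\<Sum>i<m. (\<lambda>k. edge_weight (p k) (p (Suc k))) (m - Suc i))"
    by (intro sum.cong) (auto simp: Suc_diff_Suc)
  also have "\<dots> = (\<Sum>k<m. edge_weight (p k) (p (Suc k)))" by (rule sum.nat_diff_reindex)
  also have "\<dots> = path_cost p 0 m" by (simp add: path_cost_def lessThan_atLeast0)
  finally show "path_cost (\<lambda>i. p (m - i)) 0 m \<le> wdist (p (m - 0)) (p (m - m))"
    using g by (simp add: geod_path_cost wdist_commute)
qed

lemma path_gadj: "\<lbrakk>path p m; k < m\<rbrakk> \<Longrightarrow> gadj (p k) (p (Suc k))"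
  by (simp add: path_def)

lemma path_swap: "path p m \<Longrightarrow> path (prod.swap \<circ> p) m"
  by (simp add: path_def gadj_swap)

lemma visit_col:
  assumes p: "path p m" and ij: "i \<le> j" "j \<le> m"
    and z: "min (fst (p i)) (fst (p j)) \<le> z" "z \<le> max (fst (p i)) (fst (p j))"
  obtains k where "i \<le> k" "k \<le> j" "fst (p k) = z"
proof -
  have step: "\<bar>fst (p (Suc k)) - fst (p k)\<bar> \<le> 1" if "k < m" for k
    using path_gadj[OF p that] by (auto simp: gadj_def)
  show ?thesis
  proof (cases "fst (p i) \<le> fst (p j)")
    case True
    then have "\<exists>k\<ge>i. k \<le> j \<and> fst (p k) = z"
      using step ij z by (intro nat_intermed_int_val) auto
    then show ?thesis using that by blast
  next
    case False
    then have "\<exists>k\<ge>i. k \<le> j \<and> - fst (p k) = - z"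
      using step ij z by (intro nat_intermed_int_val) (auto simp: abs_minus_commute)
    then show ?thesis using that by auto
  qed
qed

lemma visit_row:
  assumes "path p m" "i \<le> j" "j \<le> m"
    and "min (snd (p i)) (snd (p j)) \<le> z" "z \<le> max (snd (p i)) (snd (p j))"
  obtains k where "i \<le> k" "k \<le> j" "snd (p k) = z"
  using visit_col[OF path_swap, of p m i j z] assms by auto

text \<open>The two coordinates are projected separately: each horizontal step costs at least what
  it would on a row of level \<open>b\<close>, each vertical step at least what it would on a column
  of level \<open>a\<close>. The triangle inequality for \<open>line_cost\<close> adds the steps
  up.\<close>

lemma path_cost_lower:
  assumes p: "path p m" and ij: "i \<le> j" "j \<le> m"
    and H: "\<And>k. \<lbrakk>i \<le> k; k < j; snd (p k) = snd (p (Suc k))\<rbrakk> \<Longrightarrow> lev (snd (p k)) \<le> b"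
    and V: "\<And>k. \<lbrakk>i \<le> k; k < j; fst (p k) = fst (p (Suc k))\<rbrakk> \<Longrightarrow> lev (fst (p k)) \<le> a"
  shows "line_cost b (fst (p i)) (fst (p j)) + line_cost a (snd (p i)) (snd (p j)) \<le> path_cost p i j"
  using ij H V
proof (induction j rule: dec_induct)
  case (step k)
  have "line_cost b (fst (p k)) (fst (p (Suc k))) + line_cost a (snd (p k)) (snd (p (Suc k))) \<le> edge_weight (p k) (p (Suc k))"
  proof -
    have "gadj (p k) (p (Suc k))" using path_gadj[OF p] step by simp
    then show ?thesis
    proof (cases rule: gadj_cases)
      case H
      then show ?thesis
        using step.prems(2)[of k] step.hyps by (simp add: edge_weight_H line_cost_antimono)
    next
      case V
      then show ?thesis
        using step.prems(3)[of k] step.hyps \<open>gadj (p k) (p (Suc k))\<close> by (simp add: edge_weight_V line_cost_antimono)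
    qed
  qed
  moreover have "line_cost b (fst (p i)) (fst (p k)) + line_cost a (snd (p i)) (snd (p k)) \<le> path_cost p i k"
    using step by auto
  ultimately show ?case
    using line_cost_triangle[of b "fst (p i)" "fst (p (Suc k))" "fst (p k)"]
      line_cost_triangle[of a "snd (p i)" "snd (p (Suc k))" "snd (p k)"] step.hyps
    by (simp add: path_cost_Suc)
qed simp

lemma path_cost_lower_col:
  assumes p: "path p m" and ij: "i \<le> j" "j \<le> m"
    and V: "\<And>k. \<lbrakk>i \<le> k; k < j; fst (p k) = fst (p (Suc k))\<rbrakk> \<Longrightarrow> lev (fst (p k)) \<le> a"
  shows "\<bar>fst (p i) - fst (p j)\<bar> + int (line_cost a (snd (p i)) (snd (p j))) \<le> int (path_cost p i j)"
proof -
  \<comment> \<open>No bound on the rows is given, so the best row of the path serves as one;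
    afterwards only the length of the horizontal part is kept.\<close>
  let ?b = "Max ((\<lambda>k. lev (snd (p k))) ` {..m})"
  have "line_cost ?b (fst (p i)) (fst (p j)) + line_cost a (snd (p i)) (snd (p j)) \<le> path_cost p i j"
    using ij by (intro path_cost_lower[OF p] V) (auto intro!: Max_ge)
  then show ?thesis using line_cost_ge[of "fst (p i)" "fst (p j)" ?b] by linarith
qed

text \<open>Leaving column \<open>c\<close> adds horizontal length, and the vertical part cannot
  become cheaper because no visited column has a higher level.\<close>

lemma straight_col:
  assumes g: "geod p m" and ij: "i \<le> k" "k \<le> j" "j \<le> m"
    and c: "fst (p i) = c" "fst (p j) = c"
    and lev: "\<And>k. \<lbrakk>i \<le> k; k \<le> j\<rbrakk> \<Longrightarrow> lev (fst (p k)) \<le> lev c"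
  shows "fst (p k) = c"
proof -
  have "path_cost p i j \<le> line_cost (lev c) (snd (p i)) (snd (p j))"
    using geod_path_cost[OF g, of i j] ij c wdist_col[of c "snd (p i)" "snd (p j)"]
    by (metis order.trans prod.collapse)
  moreover have "\<bar>fst (p i) - fst (p k)\<bar> + int (line_cost (lev c) (snd (p i)) (snd (p k))) \<le> int (path_cost p i k)"
    "\<bar>fst (p k) - fst (p j)\<bar> + int (line_cost (lev c) (snd (p k)) (snd (p j))) \<le> int (path_cost p k j)"
    using ij by (auto intro!: path_cost_lower_col[OF geod_path[OF g]] lev)
  moreover have "path_cost p i k + path_cost p k j = path_cost p i j" using ij by (intro path_cost_add)
  ultimately show ?thesis
    using line_cost_triangle[of "lev c" "snd (p i)" "snd (p j)" "snd (p k)"] c by linarith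
qed

section \<open>The crossing of the best lines\<close>

definition best :: "(nat \<Rightarrow> int) \<Rightarrow> nat \<Rightarrow> nat \<Rightarrow> int \<Rightarrow> bool" where
  "best f i j c \<longleftrightarrow> (\<exists>k. i \<le> k \<and> k \<le> j \<and> f k = c) \<and> (\<forall>k. i \<le> k \<longrightarrow> k \<le> j \<longrightarrow> f k \<noteq> c \<longrightarrow> lev (f k) < lev c)"

text \<open>Two visited columns of equal maximal level would enclose a better one by
  \<open>lev_between\<close>, and the path visits every column in between.\<close>

lemma ex_best_col:
  assumes p: "path p m" and ij: "i \<le> j" "j \<le> m"
  shows "\<exists>c. best (\<lambda>k. fst (p k)) i j c"
proof -
  let ?L = "(\<lambda>k. lev (fst (p k))) ` {i..j}"
  have "Max ?L \<in> ?L" using ij by (intro Max_in) auto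
  then obtain k0 where k0: "i \<le> k0" "k0 \<le> j" "lev (fst (p k0)) = Max ?L" by auto
  have le: "lev (fst (p k)) \<le> lev (fst (p k0))" if "i \<le> k" "k \<le> j" for k
    unfolding k0(3) using that by (intro Max_ge) auto
  have "lev (fst (p k)) < lev (fst (p k0))" if k: "i \<le> k" "k \<le> j" "fst (p k) \<noteq> fst (p k0)" for k
  proof (rule ccontr)
    assume "\<not> ?thesis"
    then have eq: "lev (fst (p k)) = lev (fst (p k0))" using le k by force
    from lev_between[OF this k(3)] obtain z
      where z: "min (fst (p k)) (fst (p k0)) < z" "z < max (fst (p k)) (fst (p k0))" "lev (fst (p k)) < lev z"
      by blast
    have "\<exists>t. i \<le> t \<and> t \<le> j \<and> fst (p t) = z"
    proof (cases "k \<le> k0")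
      case True
      obtain t where "k \<le> t" "t \<le> k0" "fst (p t) = z"
        using visit_col[OF p True, of z] z k0 ij by auto
      then show ?thesis using k k0 by (intro exI[of _ t]) auto
    next
      case False
      have "min (fst (p k0)) (fst (p k)) \<le> z" "z \<le> max (fst (p k0)) (fst (p k))" "k0 \<le> k" "k \<le> m"
        using z k False ij by auto
      from visit_col[OF p this(3,4,1,2)] obtain t where "k0 \<le> t" "t \<le> k" "fst (p t) = z"
        by blast
      then show ?thesis using k k0 by (intro exI[of _ t]) auto
    qed
    then obtain t where "i \<le> t" "t \<le> j" "fst (p t) = z" by blast
    then show False using le[of t] z(3) eq by simp
  qed
  then show ?thesis using k0 unfolding best_def by (intro exI[of _ "fst (p k0)"]) auto
qed

lemma ex_best_row:
  assumes "path p m" "i \<le> j" "j \<le> m"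
  shows "\<exists>c. best (\<lambda>k. snd (p k)) i j c"
  using ex_best_col[OF path_swap] assms by simp

text \<open>Going straight along column \<open>c\<close> and then row \<open>r\<close> is never more expensive. It is strictly cheaper because
  some edge has exactly the level of \<open>r\<close> and so is charged on every other row of the path, or else the last step
  onto \<open>r\<close> is charged.\<close>

lemma corner_strict:
  assumes g: "geod p m" and ij: "i < j" "j \<le> m"
    and c: "fst (p i) = c" and r: "snd (p j) = r"
    and cols: "\<And>k. \<lbrakk>i < k; k \<le> j\<rbrakk> \<Longrightarrow> lev (fst (p k)) < lev c"
    and rows: "\<And>k. \<lbrakk>i \<le> k; k < j\<rbrakk> \<Longrightarrow> lev (snd (p k)) < lev r"
    and le: "lev r \<le> lev c"
  shows False
proof -
  define x where "x = fst (p j)"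
  define y where "y = snd (p i)"
  obtain b where b: "lev r = Suc b" using rows[of i] ij by (cases "lev r") auto
  obtain a where a: "lev c = Suc a" using cols[of j] ij by (cases "lev c") auto
  have pi: "p i = (c, y)" and pj: "p j = (x, r)" using c r by (auto simp: x_def y_def prod_eq_iff)
  have x: "lev x < lev c" using cols[of j] ij by (simp add: x_def)
  then have "x \<noteq> c" by auto
  have upper: "path_cost p i j \<le> line_cost (Suc a) y r + line_cost (Suc b) c x"
    using geod_path_cost[OF g, of i j] ij wdist_triangle[of "(c, y)" "(x, r)" "(c, r)"] wdist_col[of c y r] wdist_row[of c r x]
    by (simp add: pi pj a b)
  have lower: "line_cost b (fst (p i)) (fst (p k)) + line_cost a (snd (p i)) (snd (p k)) \<le> path_cost p i k"
    if "i \<le> k" "k \<le> j" for k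
  proof (intro path_cost_lower[OF geod_path[OF g]])
    fix k' assume "i \<le> k'" "k' < k" "fst (p k') = fst (p (Suc k'))"
    then show "lev (fst (p k')) \<le> a" using cols[of "Suc k'"] that a by simp
  next
    fix k' assume "i \<le> k'" "k' < k"
    then show "lev (snd (p k')) \<le> b" using rows[of k'] that b by simp
  qed (use that ij in auto)
  show False
  proof (cases "lev x < lev r \<and> lev r < lev c")
    case True
    \<comment> \<open>The last step goes along column \<open>x\<close> onto row \<open>r\<close> and
      has weight 2, because \<open>lev x < lev r\<close>. The bound at level \<open>a\<close>
      accounts for only 1 there, because \<open>lev r \<le> a\<close>.\<close>
    define k where "k = j - 1"
    have k: "i \<le> k" "Suc k = j" "k < j" "k < m" using ij by (auto simp: k_def)
    have adj: "gadj (p k) (p j)" using path_gadj[OF geod_path[OF g] k(4)] k(2) by simp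
    have "snd (p k) \<noteq> r" using rows[of k] k by auto
    then have fk: "fst (p k) = x" and sk: "\<bar>snd (p k) - r\<bar> = 1"
      using adj r by (auto elim: gadj_cases simp: x_def)
    define s where "s = snd (p k)"
    have edge_count: "edge_count l s r = of_bool (l < lev r)" for l
    proof (cases "s = r - 1")
      case True
      then show ?thesis using edge_count_unit[of l s] edge_lev_right[of r] b by simp
    next
      case False
      then have "s = r + 1" using sk by (simp add: s_def)
      then show ?thesis using edge_count_unit[of l r] edge_lev_left[of r] b by (simp add: edge_count_commute)
    qed
    have "edge_weight (p k) (p j) = 2"
      using edge_weight_V[OF adj] fk sk edge_count[of "lev x"] True r by (simp add: x_def line_cost_def s_def)
    moreover have "line_cost a s r = 1" using edge_count[of a] sk True a by (simp add: line_cost_def s_def)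
    moreover have "path_cost p i j = path_cost p i k + edge_weight (p k) (p j)" using path_cost_Suc[OF k(1), of p] k(2) by simp
    moreover have "line_cost b c x + line_cost a y s \<le> path_cost p i k" using lower[of k] k fk pi by (simp add: s_def)
    moreover have "line_cost a y r \<le> line_cost a y s + line_cost a s r" by (rule line_cost_triangle)
    moreover have "line_cost (Suc a) y r \<le> line_cost a y r" "line_cost (Suc b) c x \<le> line_cost b c x" by (auto intro: line_cost_antimono)
    ultimately show False using upper by linarith
  next
    case False
    \<comment> \<open>The edge lies at \<open>c\<close> if \<open>c\<close> and \<open>r\<close>
      have equal levels, at \<open>x\<close> if \<open>x\<close> and \<open>r\<close> do, and
      otherwise at distance \<open>2 ^ lev r\<close> from \<open>c\<close> towards \<open>x\<close>,
      which does not overshoot because \<open>c\<close> and \<open>x\<close> are then at least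
      \<open>2 * 2 ^ lev r\<close> apart.\<close>
    have "\<exists>e. min c x \<le> e \<and> e < max c x \<and> edge_lev e = Suc b"
    proof -
      consider "lev r = lev c" | "lev r < lev c" "lev x = lev r" | "lev r < lev c" "lev r < lev x"
        using False le by linarith
      then show ?thesis
      proof cases
        case 1
        show ?thesis
        proof (cases "c < x")
          case True
          then show ?thesis using edge_lev_left[of c] 1 b by (intro exI[of _ c]) auto
        next
          case False
          then show ?thesis using edge_lev_right[of c] 1 b \<open>x \<noteq> c\<close> by (intro exI[of _ "c - 1"]) auto
        qed
      next
        case 2
        show ?thesis
        proof (cases "c < x")
          case True
          then show ?thesis using edge_lev_right[of x] 2 b by (intro exI[of _ "x - 1"]) auto
        next
          case False
          then show ?thesis using edge_lev_left[of x] 2 b \<open>x \<noteq> c\<close> by (intro exI[of _ "x"]) auto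
        qed
      next
        case 3
        have far: "2 * 2 ^ lev r \<le> \<bar>c - x\<bar>"
          using dist_ge_if_lev[of "Suc (lev r)" c x] 3 \<open>x \<noteq> c\<close> by simp
        have pos: "(0::int) < 2 ^ lev r" by simp
        show ?thesis
        proof (cases "c < x")
          case True
          have "lev (c + 2 ^ lev r) = lev r" using 3 by (intro lev_add_eq) auto
          then show ?thesis using edge_lev_right[of "c + 2 ^ lev r"] far pos b True
            by (intro exI[of _ "c + 2 ^ lev r - 1"]) auto
        next
          case False
          have "lev (c + - (2 ^ lev r)) = lev r" using 3 by (intro lev_add_eq) auto
          then show ?thesis using edge_lev_left[of "c + - (2 ^ lev r)"] far pos b False
            by (intro exI[of _ "c + - (2 ^ lev r)"]) auto
        qed
      qed
    qed
    then have "edge_count (Suc b) c x < edge_count b c x" using edge_count_strict by blast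
    then have "line_cost (Suc b) c x < line_cost b c x" by (simp add: line_cost_def)
    moreover have "line_cost (Suc a) y r \<le> line_cost a y r" by (auto intro: line_cost_antimono)
    moreover have "line_cost b c x + line_cost a y r \<le> path_cost p i j" using lower[of j] ij by (simp add: pi pj)
    ultimately show False using upper by linarith
  qed
qed

lemma corner_strict_rev:
  assumes g: "geod p m" and ij: "i < j" "j \<le> m"
    and c: "fst (p j) = c" and r: "snd (p i) = r"
    and cols: "\<And>k. \<lbrakk>i \<le> k; k < j\<rbrakk> \<Longrightarrow> lev (fst (p k)) < lev c"
    and rows: "\<And>k. \<lbrakk>i < k; k \<le> j\<rbrakk> \<Longrightarrow> lev (snd (p k)) < lev r"
    and le: "lev r \<le> lev c"
  shows False
  by (rule corner_strict[OF geod_rev[OF g], of "m - j" "m - i" c r]) (use assms in auto)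

text \<open>A visit to column \<open>c\<close> and a visit to row \<open>r\<close> are chosen as
  close in time as possible, so the path meets neither line strictly in between. If the two times
  differed, \<open>corner_strict\<close> would apply to the piece between them, after a reversal or
  an exchange of coordinates according to which visit comes first and which line has the higher
  level.\<close>

lemma corner:
  assumes g: "geod p m" and ij: "i \<le> j" "j \<le> m"
    and c: "best (\<lambda>k. fst (p k)) i j c" and r: "best (\<lambda>k. snd (p k)) i j r"
  obtains k where "i \<le> k" "k \<le> j" "p k = (c, r)"
proof -
  define P where "P = (\<lambda>(k, l). i \<le> k \<and> k \<le> j \<and> i \<le> l \<and> l \<le> j \<and> fst (p k) = c \<and> snd (p l) = r)"
  have "\<exists>kl. P kl" using c r unfolding P_def best_def by auto
  then obtain kl where kl: "P kl" "\<And>kl'. P kl' \<Longrightarrow> (\<lambda>(k, l). nat \<bar>int k - int l\<bar>) kl \<le> (\<lambda>(k, l). nat \<bar>int k - int l\<bar>) kl'"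
    using ex_has_least_nat[of P _ "\<lambda>(k, l). nat \<bar>int k - int l\<bar>"] by blast
  obtain k l where "kl = (k, l)" by fastforce
  with kl have k: "i \<le> k" "k \<le> j" "fst (p k) = c" and l: "i \<le> l" "l \<le> j" "snd (p l) = r"
    and min: "\<And>k' l'. P (k', l') \<Longrightarrow> \<bar>int k - int l\<bar> \<le> \<bar>int k' - int l'\<bar>"
    by (auto simp: P_def) (force simp: P_def)
  have cols: "lev (fst (p t)) < lev c" if "i \<le> t" "t \<le> j" "\<bar>int t - int l\<bar> < \<bar>int k - int l\<bar>" for t
  proof -
    have "fst (p t) \<noteq> c" using min[of t l] that l by (auto simp: P_def)
    then show ?thesis using c that unfolding best_def by blast
  qed
  have rows: "lev (snd (p t)) < lev r" if "i \<le> t" "t \<le> j" "\<bar>int k - int t\<bar> < \<bar>int k - int l\<bar>" for t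
  proof -
    have "snd (p t) \<noteq> r" using min[of k t] that k by (auto simp: P_def)
    then show ?thesis using r that unfolding best_def by blast
  qed
  consider "k = l" | "k < l" "lev r \<le> lev c" | "l < k" "lev r \<le> lev c" | "k < l" "lev c \<le> lev r" | "l < k" "lev c \<le> lev r"
    by linarith
  then show ?thesis
  proof cases
    case 1
    then show ?thesis using that k l by (auto simp: prod_eq_iff)
  next
    case 2
    then have False using k l ij by (intro corner_strict[OF g, of k l c r] cols rows) auto
    then show ?thesis ..
  next
    case 3
    then have False using k l ij by (intro corner_strict_rev[OF g, of l k c r] cols rows) auto
    then show ?thesis ..
  next
    case 4
    then have False using k l ij cols rows by (intro corner_strict_rev[OF geod_swap[OF g], of k l r c]) auto
    then show ?thesis ..
  next
    case 5
    then have False using k l ij cols rows by (intro corner_strict[OF geod_swap[OF g], of l k r c]) auto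
    then show ?thesis ..
  qed
qed

section \<open>Unimodality of the levels along a geodesic\<close>

lemma best_less: "\<lbrakk>best f i j c; i \<le> k; k \<le> j; f k \<noteq> c\<rbrakk> \<Longrightarrow> lev (f k) < lev c"
  by (simp add: best_def)

lemma best_le: "\<lbrakk>best f i j c; i \<le> k; k \<le> j\<rbrakk> \<Longrightarrow> lev (f k) \<le> lev c"
  by (cases "f k = c") (auto dest: best_less)

text \<open>The best column is met only at time \<open>j\<close>, so \<open>corner\<close> puts
  \<open>p j\<close> on the best row \<open>r\<close>. The step into \<open>p j\<close> changes the
  column, so the vertex before it is on \<open>r\<close> too, and \<open>corner\<close> for the
  piece shortened by this step puts \<open>p i\<close> on \<open>r\<close>. Now
  \<open>straight_col\<close>, with coordinates exchanged, confines the whole piece to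
  \<open>r\<close>, which leaves no room for a vertical step.\<close>

lemma unimodal_aux:
  assumes g: "geod p m" and k: "i \<le> k" "Suc k \<le> j" "j \<le> m"
    and V: "fst (p k) = fst (p (Suc k))"
    and inside: "\<And>t. \<lbrakk>i < t; t < j\<rbrakk> \<Longrightarrow> lev (fst (p t)) < lev (fst (p i))"
    and lt: "lev (fst (p i)) < lev (fst (p j))" and ik: "fst (p k) \<noteq> fst (p i)"
  shows False
proof -
  define c1 c2 where "c1 = fst (p i)" and "c2 = fst (p j)"
  have ikj: "i < k" "i < j" using k ik by (auto simp: order.order_iff_strict)
  have small: "lev (fst (p t)) < lev c2" if "i \<le> t" "t < j" for t
    using inside[of t] lt that by (cases "i = t") (auto simp: c2_def)
  have "best (\<lambda>k. fst (p k)) i j c2"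
    unfolding best_def
  proof (intro conjI allI impI)
    show "\<exists>k\<ge>i. k \<le> j \<and> fst (p k) = c2" using ikj by (intro exI[of _ j]) (auto simp: c2_def)
  next
    fix t assume "i \<le> t" "t \<le> j" "fst (p t) \<noteq> c2"
    then show "lev (fst (p t)) < lev c2" using small[of t] by (cases "t = j") (auto simp: c2_def)
  qed
  moreover obtain r where r: "best (\<lambda>k. snd (p k)) i j r"
    using ex_best_row[OF geod_path[OF g], of i j] ikj k by auto
  ultimately obtain t where t: "i \<le> t" "t \<le> j" "p t = (c2, r)"
    using corner[OF g, of i j c2 r] k ikj by auto
  then have "t = j" using small[of t] by (cases "t < j") auto
  then have pj: "p j = (c2, r)" using t by simp
  define j' where "j' = j - 1"
  have j': "Suc j' = j" "i \<le> j'" "j' \<le> m" "j' < j" using ikj k by (auto simp: j'_def)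
  have "gadj (p j') (p j)" using path_gadj[OF geod_path[OF g], of j'] j' k by simp
  moreover have "fst (p j') \<noteq> fst (p j)" using small[of j'] j' by (auto simp: c2_def)
  ultimately have rj': "snd (p j') = r" using pj by (auto elim: gadj_cases)
  have "best (\<lambda>k. fst (p k)) i j' c1"
    unfolding best_def
  proof (intro conjI allI impI)
    show "\<exists>k\<ge>i. k \<le> j' \<and> fst (p k) = c1" using j' by (intro exI[of _ i]) (auto simp: c1_def)
  next
    fix t assume "i \<le> t" "t \<le> j'" "fst (p t) \<noteq> c1"
    then show "lev (fst (p t)) < lev c1" using inside[of t] j' by (cases "t = i") (auto simp: c1_def)
  qed
  moreover have "best (\<lambda>k. snd (p k)) i j' r"
    using r rj' j' unfolding best_def by auto
  ultimately obtain t where t: "i \<le> t" "t \<le> j'" "p t = (c1, r)"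
    using corner[OF g j'(2,3), of c1 r] by auto
  have "t = i"
  proof (rule ccontr)
    assume "t \<noteq> i"
    then have "lev (fst (p t)) < lev (fst (p i))" using t j' by (intro inside) auto
    then show False using t by (simp add: c1_def)
  qed
  then have ri: "snd (p i) = r" using t by simp
  have row: "snd (p t) = r" if "i \<le> t" "t \<le> j" for t
    using straight_col[OF geod_swap[OF g], of i t j r] that k ri pj best_le[OF r] by simp
  have "p k = p (Suc k)" using row[of k] row[of "Suc k"] V k by (simp add: prod_eq_iff)
  then show False using gadj_neq[OF path_gadj[OF geod_path[OF g], of k]] k by simp
qed

text \<open>Consider the last better column before the vertical step and the first one after it. If
  they coincide, \<open>straight_col\<close> keeps the path on that column; if they differ but have
  equal levels, a still better column is met in between; otherwise \<open>unimodal_aux\<close>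
  applies to the path or to its reverse, starting at the lower of the two. Horizontal steps are
  exempt because they cross columns of all levels.\<close>

lemma unimodal_col:
  assumes g: "geod p m" and k: "i \<le> k" "Suc k \<le> j" "j \<le> m"
    and V: "fst (p k) = fst (p (Suc k))"
    and i: "lev (fst (p k)) < lev (fst (p i))" and j: "lev (fst (p k)) < lev (fst (p j))"
  shows False
proof -
  define I where "I = {t \<in> {i..k}. lev (fst (p k)) < lev (fst (p t))}"
  define J where "J = {t \<in> {Suc k..j}. lev (fst (p k)) < lev (fst (p t))}"
  have fin: "finite I" "finite J" by (auto simp: I_def J_def)
  have "i \<in> I" "j \<in> J" using i j k by (auto simp: I_def J_def)
  define i' where "i' = Max I"
  define j' where "j' = Min J"
  have "i' \<in> I" "j' \<in> J" unfolding i'_def j'_def using fin \<open>i \<in> I\<close> \<open>j \<in> J\<close> by (auto intro: Max_in Min_in)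
  then have i': "i \<le> i'" "i' \<le> k" "lev (fst (p k)) < lev (fst (p i'))"
    and j': "Suc k \<le> j'" "j' \<le> j" "lev (fst (p k)) < lev (fst (p j'))" by (auto simp: I_def J_def)
  have inside: "lev (fst (p t)) \<le> lev (fst (p k))" if "i' < t" "t < j'" for t
  proof (rule ccontr)
    assume "\<not> ?thesis"
    then have "t \<in> I \<or> t \<in> J" using that i' j' by (auto simp: I_def J_def)
    then show False using Max_ge[OF fin(1), of t] Min_le[OF fin(2), of t] that by (auto simp: i'_def j'_def)
  qed
  consider "fst (p i') = fst (p j')" | "fst (p i') \<noteq> fst (p j')" "lev (fst (p i')) = lev (fst (p j'))"
    | "lev (fst (p i')) < lev (fst (p j'))" | "lev (fst (p j')) < lev (fst (p i'))"
    by linarith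
  then show False
  proof cases
    case 1
    have "lev (fst (p t)) \<le> lev (fst (p i'))" if "i' \<le> t" "t \<le> j'" for t
      using inside[of t] that i' 1 by (cases "t = i' \<or> t = j'") auto
    moreover have "i' \<le> k" "k \<le> j'" "j' \<le> m" using i' j' k by auto
    ultimately have "fst (p k) = fst (p i')"
      using 1 by (intro straight_col[OF g, of i' k j' "fst (p i')"]) auto
    then show False using i' by simp
  next
    case 2
    from lev_between[OF 2(2,1)] obtain z where
      z: "min (fst (p i')) (fst (p j')) < z" "z < max (fst (p i')) (fst (p j'))" "lev (fst (p i')) < lev z"
      by blast
    obtain t where t: "i' \<le> t" "t \<le> j'" "fst (p t) = z"
    proof -
      have "i' \<le> j'" "j' \<le> m" using i' j' k by auto
      from visit_col[OF geod_path[OF g] this] z show ?thesis using that by (metis less_imp_le)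
    qed
    then have "t \<noteq> i'" "t \<noteq> j'" using z 2 by auto
    then show False using inside[of t] t z i' by auto
  next
    case 3
    show False
      by (rule unimodal_aux[OF g, of i' k j'])
        (use i' j' k V 3 inside in \<open>auto intro: le_less_trans[OF inside]\<close>)
  next
    case 4
    have *: "m - (m - t) = t" if "t \<le> m" for t using that by simp
    have Sk: "Suc (m - Suc k) = m - k" using k by simp
    show False
    proof (rule unimodal_aux[OF geod_rev[OF g], of "m - j'" "m - Suc k" "m - i'"])
      fix t assume t: "m - j' < t" "t < m - i'"
      then have "i' < m - t" "m - t < j'" using k i' j' by auto
      then show "lev (fst (p (m - t))) < lev (fst (p (m - (m - j'))))"
        using inside[of "m - t"] j' k by (simp add: *)
    qed (use i' j' k V 4 Sk in \<open>auto simp: *\<close>)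
  qed
qed

section \<open>How far a geodesic gets on a column that it later leaves for a better one\<close>

lemma ex_lev_ge_between:
  assumes "2 ^ l \<le> \<bar>a - b\<bar>"
  obtains n where "min a b \<le> n" "n \<le> max a b" "\<bar>n - a\<bar> < 2 ^ l" "l \<le> lev n"
proof (cases "a \<le> b")
  case True
  obtain n where "a \<le> n" "n < a + 2 ^ l" "l \<le> lev n" using ex_lev_ge by blast
  then show ?thesis using assms True by (intro that[of n]) auto
next
  case False
  obtain n where "a - 2 ^ l + 1 \<le> n" "n < a - 2 ^ l + 1 + 2 ^ l" "l \<le> lev n" using ex_lev_ge by blast
  then show ?thesis using assms False by (intro that[of n]) auto
qed

lemma ex_lev_eq_between:
  assumes "2 * 2 ^ l < \<bar>a - b\<bar>"
  obtains n where "min a b < n" "n < max a b" "lev n = l"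
proof -
  obtain n where "min a b + 1 \<le> n" "n < min a b + 1 + 2 * 2 ^ l" "lev n = l"
    using ex_lev_eq by blast
  then show ?thesis using assms by (intro that[of n]) linarith+
qed

text \<open>If the vertical distance were larger, then moving to the better column early, along a good row close
  to the start, would save two charges at a cost of at most one.\<close>

lemma near_start:
  assumes g: "geod p m" and k: "k \<le> j" "j \<le> m"
    and before: "\<And>t. t \<le> k \<Longrightarrow> lev (fst (p t)) \<le> lev (fst (p k))"
    and after: "lev (fst (p k)) < lev (fst (p j))"
  shows "\<bar>fst (p 0) - fst (p k)\<bar> < 2 ^ lev (fst (p k))"
    and "\<bar>snd (p 0) - snd (p k)\<bar> \<le> 6 * 2 ^ lev (fst (p k))"
proof -
  define x y l where "x = fst (p k)" and "y = snd (p k)" and "l = lev x"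
  note pa = geod_path[OF g]
  have pos: "(0::int) < 2 ^ l" by simp
  show "\<bar>fst (p 0) - fst (p k)\<bar> < 2 ^ lev (fst (p k))"
  proof (rule ccontr)
    assume far: "\<not> ?thesis"
    \<comment> \<open>The column at distance \<open>2 ^ l\<close> from \<open>x\<close> towards the
      start is better than \<open>x\<close> and would be visited before time
      \<open>k\<close>.\<close>
    define s where "s = (if fst (p 0) < x then - (2 ^ l) else 2 ^ l :: int)"
    have "\<bar>s\<bar> = 2 ^ lev x" by (simp add: s_def l_def)
    then have "lev x < lev (x + s)" by (rule lev_add_gt)
    moreover have "min (fst (p 0)) (fst (p k)) \<le> x + s" "x + s \<le> max (fst (p 0)) (fst (p k))"
      using far pos by (auto simp: s_def l_def x_def)
    then obtain t where "t \<le> k" "fst (p t) = x + s"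
      using visit_col[OF pa, of 0 k "x + s"] k by auto
    ultimately show False using before[of t] by (simp add: x_def)
  qed
  show "\<bar>snd (p 0) - snd (p k)\<bar> \<le> 6 * 2 ^ lev (fst (p k))"
  proof (rule ccontr)
    assume "\<not> ?thesis"
    then have far: "6 * 2 ^ l < \<bar>snd (p 0) - y\<bar>" by (simp add: l_def x_def y_def)
    \<comment> \<open>Finding \<open>r\<close> uses up less than \<open>2 ^ l\<close> of the
      vertical distance. More than \<open>5 * 2 ^ l\<close> remains up to \<open>y\<close>, and
      \<open>4 * 2 ^ l\<close> is enough for a row \<open>z\<close> of level exactly
      \<open>Suc l\<close>.\<close>
    obtain r where r: "min (snd (p 0)) y \<le> r" "r \<le> max (snd (p 0)) y" "\<bar>r - snd (p 0)\<bar> < 2 ^ l" "l \<le> lev r"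
      using ex_lev_ge_between[of l "snd (p 0)" y] far pos by auto
    obtain i where i: "i \<le> k" "snd (p i) = r"
      using visit_row[OF pa, of 0 k r] r k by (auto simp: y_def)
    have "2 * 2 ^ Suc l < \<bar>r - y\<bar>" using far r(3) pos by simp
    then obtain z where z: "min r y < z" "z < max r y" "lev z = Suc l" using ex_lev_eq_between by blast
    define J where "J = {t \<in> {k..j}. l < lev (fst (p t))}"
    have "finite J" "j \<in> J" using k after by (auto simp: J_def l_def x_def)
    define j' where "j' = Min J"
    have "j' \<in> J" using \<open>finite J\<close> \<open>j \<in> J\<close> unfolding j'_def by (auto intro: Min_in)
    then have j': "k \<le> j'" "j' \<le> j" "l < lev (fst (p j'))" by (auto simp: J_def)
    have low: "lev (fst (p t)) \<le> l" if "t < j'" for t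
    proof (cases "t \<le> k")
      case True
      then show ?thesis using before by (simp add: l_def x_def)
    next
      case False
      then show ?thesis using that Min_le[OF \<open>finite J\<close>, of t] j' unfolding j'_def[symmetric]
        by (force simp: J_def)
    qed
    define c where "c = fst (p j')"
    define yj where "yj = snd (p j')"
    \<comment> \<open>The competitor follows row \<open>r\<close> to \<open>c\<close>, the first
      column of level above \<open>l\<close>, and then stays on \<open>c\<close>. On the row only
      the edge that meets \<open>c\<close> can be charged; on the column the two edges at
      \<open>z\<close> are saved.\<close>
    have "wdist (p i) (p j') \<le> wdist (fst (p i), r) (c, r) + wdist (c, r) (c, yj)"
      using wdist_triangle[of "p i" "p j'" "(c, r)"] i by (metis c_def prod.collapse yj_def)
    also have "\<dots> \<le> line_cost (lev r) (fst (p i)) c + line_cost (lev c) r yj" by (intro add_mono wdist_row wdist_col)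
    also have "\<dots> \<le> line_cost l (fst (p i)) c + line_cost (Suc l) r yj"
      using r(4) j'(3) by (intro add_mono line_cost_antimono) (auto simp: c_def)
    finally have upper: "wdist (p i) (p j') \<le> line_cost l (fst (p i)) c + line_cost (Suc l) r yj" .
    have "edge_count l (fst (p i)) c \<le> 1"
    proof (rule edge_count_le_one)
      fix z assume "min (fst (p i)) c \<le> z" "z \<le> max (fst (p i)) c" "z \<noteq> c"
      then obtain t where "i \<le> t" "t \<le> j'" "fst (p t) = z"
        using visit_col[OF pa, of i j' z] i j' k unfolding c_def by (metis order.trans)
      then show "lev z \<le> l" using low[of t] \<open>z \<noteq> c\<close> by (cases "t = j'") (auto simp: c_def)
    qed
    moreover have "line_cost (Suc l) r yj \<le> line_cost (Suc l) r y + line_cost (Suc l) y yj" by (rule line_cost_triangle)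
    moreover have "line_cost (Suc l) r y + 2 \<le> line_cost l r y" by (rule line_cost_inside[OF z])
    moreover have "line_cost (Suc l) y yj \<le> line_cost l y yj" by (rule line_cost_antimono) simp
    moreover have "\<bar>fst (p i) - fst (p k)\<bar> + int (line_cost l (snd (p i)) (snd (p k))) \<le> int (path_cost p i k)"
      using i j' k by (intro path_cost_lower_col[OF pa] low) auto
    moreover have "\<bar>fst (p k) - fst (p j')\<bar> + int (line_cost l (snd (p k)) (snd (p j'))) \<le> int (path_cost p k j')"
      using i j' k by (intro path_cost_lower_col[OF pa] low) auto
    moreover have "path_cost p i k + path_cost p k j' = wdist (p i) (p j')"
      using path_cost_add[of i k j' p] geod_path_cost[OF g, of i j'] i j' k by simp
    moreover have "int (line_cost l (fst (p i)) c) = \<bar>fst (p i) - c\<bar> + int (edge_count l (fst (p i)) c)"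
      by (simp add: line_cost_def)
    ultimately show False
      using upper i by (simp add: c_def y_def yj_def)
  qed
qed

section \<open>The number of best columns\<close>

definition best_cols :: "int \<times> int \<Rightarrow> int \<times> int \<Rightarrow> int set" where
  "best_cols u v = {c. \<exists>p m. geod p m \<and> p 0 = u \<and> p m = v \<and> best (\<lambda>k. fst (p k)) 0 m c}"

lemma best_cols_between:
  assumes "path p m" "best (\<lambda>k. fst (p k)) 0 m c" "i \<le> m" "j \<le> m"
    and "min (fst (p i)) (fst (p j)) \<le> z" "z \<le> max (fst (p i)) (fst (p j))"
  shows "lev z \<le> lev c"
proof -
  obtain t where "t \<le> m" "fst (p t) = z"
  proof (cases "i \<le> j")
    case True
    from visit_col[OF assms(1) True assms(4,5,6)] show ?thesis using that assms(4) by (metis order.trans)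
  next
    case False
    then have "j \<le> i" by simp
    have "min (fst (p j)) (fst (p i)) \<le> z" "z \<le> max (fst (p j)) (fst (p i))"
      using assms(5,6) by (simp_all add: min.commute max.commute)
    from visit_col[OF assms(1) \<open>j \<le> i\<close> assms(3) this] show ?thesis using that assms(3) by (metis order.trans)
  qed
  then show ?thesis using best_le[OF assms(2), of t] by simp
qed

text \<open>A better column between two best columns of equal level would lie between
  \<open>fst u\<close> and one of them, and so be met by the very geodesic for which that one is
  best.\<close>

lemma inj_on_best_cols: "inj_on lev (best_cols u v)"
proof (rule inj_onI, rule ccontr)
  fix c c' assume c: "c \<in> best_cols u v" and c': "c' \<in> best_cols u v" and eq: "lev c = lev c'" "c \<noteq> c'"
  obtain p m where p: "geod p m" "p 0 = u" "p m = v" "best (\<lambda>k. fst (p k)) 0 m c"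
    using c by (auto simp: best_cols_def)
  obtain p' m' where p': "geod p' m'" "p' 0 = u" "p' m' = v" "best (\<lambda>k. fst (p' k)) 0 m' c'"
    using c' by (auto simp: best_cols_def)
  obtain s where s: "s \<le> m" "fst (p s) = c" using p(4) by (auto simp: best_def)
  obtain s' where s': "s' \<le> m'" "fst (p' s') = c'" using p'(4) by (auto simp: best_def)
  from lev_between[OF eq] obtain z where z: "min c c' < z" "z < max c c'" "lev c < lev z" by blast
  have "lev z \<le> lev c"
  proof (cases "min c (fst u) \<le> z \<and> z \<le> max c (fst u)")
    case True
    then show ?thesis using best_cols_between[OF geod_path[OF p(1)] p(4) s(1), of 0 z] s p by simp
  next
    case False
    then have "min c' (fst u) \<le> z \<and> z \<le> max c' (fst u)" using z by (auto simp: min_def max_def split: if_splits)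
    then show ?thesis using best_cols_between[OF geod_path[OF p'(1)] p'(4) s'(1), of 0 z] s' p' eq by simp
  qed
  then show False using z by simp
qed

text \<open>With \<open>X = 2 ^ lev c'\<close>, the detour from \<open>c'\<close> to \<open>c''\<close> costs at least \<open>2 * X\<close>, so it pays off only if the
  endpoints are about \<open>X\<^sup>2\<close> apart vertically. At that distance the detour from \<open>c\<close> to \<open>c'\<close> would be a
  strict gain.\<close>

lemma three_best_cols:
  assumes c: "c \<in> best_cols u v" and c': "c' \<in> best_cols u v" and c'': "c'' \<in> best_cols u v"
    and lev: "lev c + 3 \<le> lev c'" "lev c' < lev c''"
    and side: "fst u < c' \<and> fst u < c'' \<or> c' < fst u \<and> c'' < fst u"
  shows False
proof -
  define X :: int where "X = 2 ^ lev c'"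
  obtain p m where p: "geod p m" "p 0 = u" "p m = v" "best (\<lambda>k. fst (p k)) 0 m c"
    using c by (auto simp: best_cols_def)
  obtain p' m' where p': "geod p' m'" "p' 0 = u" "p' m' = v" "best (\<lambda>k. fst (p' k)) 0 m' c'"
    using c' by (auto simp: best_cols_def)
  obtain q n where q: "geod q n" "q 0 = u" "q n = v" "best (\<lambda>k. fst (q k)) 0 n c''"
    using c'' by (auto simp: best_cols_def)
  obtain s' where s': "s' \<le> m'" "fst (p' s') = c'" using p'(4) by (auto simp: best_def)
  obtain s where s: "s \<le> n" "fst (q s) = c''" using q(4) by (auto simp: best_def)
  have v: "\<not> (min (fst u) (fst v) \<le> c' \<and> c' \<le> max (fst u) (fst v))"
    using best_cols_between[OF geod_path[OF p(1)] p(4), of 0 m c'] p lev by auto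
  have u': "\<not> (min (fst u) c' \<le> c'' \<and> c'' \<le> max (fst u) c')"
    using best_cols_between[OF geod_path[OF p'(1)] p'(4), of 0 s' c''] p' s' lev by auto
  \<comment> \<open>Column \<open>c'\<close> cannot separate the endpoints, as \<open>p\<close>
    would meet it, and \<open>c''\<close> cannot lie between \<open>u\<close> and \<open>c'\<close>,
    as \<open>p'\<close> would meet it. Hence both endpoints are on one side of \<open>c'\<close>
    and \<open>c''\<close> is on the other.\<close>
  have order: "fst u < c' \<and> fst v < c' \<and> c' < c'' \<or> c' < fst u \<and> c' < fst v \<and> c'' < c'"
    using side v u' by (auto simp: min_def max_def split: if_splits)
  have near: "\<bar>fst (p' t) - c'\<bar> < X" if t: "t \<le> m'" for t
  proof (rule ccontr)
    assume far: "\<not> ?thesis"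
    define d where "d = (if fst (p' t) < c' then - X else X)"
    have "X > 0" by (simp add: X_def)
    have "\<bar>d\<bar> = 2 ^ lev c'" by (simp add: d_def X_def)
    then have "lev c' < lev (c' + d)" by (rule lev_add_gt)
    moreover have "min (fst (p' t)) c' \<le> c' + d" "c' + d \<le> max (fst (p' t)) c'"
      using far \<open>X > 0\<close> by (auto simp: d_def)
    then have "lev (c' + d) \<le> lev c'"
      using best_cols_between[OF geod_path[OF p'(1)] p'(4) t s'(1)] s' by simp
    ultimately show False by simp
  qed
  have nu: "\<bar>fst u - c'\<bar> < X" and nv: "\<bar>fst v - c'\<bar> < X" using near[of 0] near[of m'] p' by auto
  then have nuv: "\<bar>fst u - fst v\<bar> < X" using order by linarith
  have X8: "8 \<le> X" "8 * 2 ^ lev c \<le> X"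
  proof -
    have "(2::int) ^ (3 + lev c) \<le> X" unfolding X_def using lev by (intro power_increasing) auto
    then show *: "8 * 2 ^ lev c \<le> X" by (simp add: power_add)
    have "(1::int) \<le> 2 ^ lev c" by simp
    then show "8 \<le> X" using * by linarith
  qed
  have far: "X \<le> \<bar>c' - c''\<bar>"
    unfolding X_def using lev order by (intro dist_ge_if_lev) auto
  define Y where "Y = \<bar>snd u - snd v\<bar>"
  \<comment> \<open>The geodesic \<open>q\<close> passes \<open>c'\<close> on its way to
    \<open>c''\<close> and again on its way back, which adds at least \<open>2 * X\<close> to its
    length. Staying on \<open>c'\<close> would add only the charges of \<open>c'\<close>, so there
    must be at least \<open>2 * X\<close> of these between the two passages.\<close>
  have "X * X - 2 * X \<le> Y"
  proof -
    note pa = geod_path[OF q(1)]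
    have "min (fst (q 0)) (fst (q s)) \<le> c'" "c' \<le> max (fst (q 0)) (fst (q s))"
      "min (fst (q s)) (fst (q n)) \<le> c'" "c' \<le> max (fst (q s)) (fst (q n))"
      using s q order by auto
    with visit_col[OF pa, of 0 s c'] visit_col[OF pa, of s n c'] s(1)
    obtain i j where i: "i \<le> s" "fst (q i) = c'" and j: "s \<le> j" "j \<le> n" "fst (q j) = c'"
      by (metis le0 order_refl)
    define t1 t2 where "t1 = snd (q i)" and "t2 = snd (q j)"
    have "int (wdist (q i) (q j)) \<le> int (line_cost (lev c') t1 t2)"
      using wdist_col[of c' t1 t2] i j by (metis of_nat_mono prod.collapse t1_def t2_def)
    then have "int (wdist (q i) (q j)) \<le> \<bar>t1 - t2\<bar> + int (edge_count (lev c') t1 t2)" by (simp add: line_cost_def)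
    moreover have "int (wdist (q i) (q s)) + int (wdist (q s) (q j)) = int (wdist (q i) (q j))"
      using geod_wdist_add[OF q(1) i(1) j(1,2)] by linarith
    moreover have "\<bar>c' - c''\<bar> + \<bar>t1 - snd (q s)\<bar> \<le> int (wdist (q i) (q s))"
      "\<bar>c'' - c'\<bar> + \<bar>snd (q s) - t2\<bar> \<le> int (wdist (q s) (q j))"
      using wdist_ge[of "q i" "q s"] wdist_ge[of "q s" "q j"] i j s by (auto simp: t1_def t2_def)
    ultimately have "2 * X \<le> int (edge_count (lev c') t1 t2)" using far by linarith
    then have "X * (2 * X - 2) \<le> X * (int (edge_count (lev c') t1 t2) - 2)"
      using X8 by (intro mult_left_mono) auto
    also have "\<dots> \<le> \<bar>t1 - t2\<bar>" unfolding X_def by (rule edge_count_upper)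
    also have "\<dots> \<le> int (wdist (q i) (q j))" using wdist_ge[of "q i" "q j"] by (simp add: t1_def t2_def)
    also have "\<dots> \<le> int (wdist u v)"
      using geod_wdist_add[OF q(1), of 0 i n] geod_wdist_add[OF q(1), of i j n] i j s q by simp
    also have "\<dots> \<le> 2 * (\<bar>fst u - fst v\<bar> + Y)" unfolding Y_def by (rule wdist_le_twice)
    finally show ?thesis using nuv by (simp add: algebra_simps)
  qed
  \<comment> \<open>Changing from \<open>p\<close> to a route along \<open>c'\<close> costs at most
    \<open>4 * X\<close> for getting there and back, so \<open>e1 \<le> 4 * X + e2\<close>. The gap
    of 3 levels makes \<open>e1\<close> at least \<open>8 * Y / X - 2\<close>, whereas
    \<open>e2\<close> is at most \<open>Y / X + 2\<close>.\<close>
  moreover have "7 * Y \<le> 4 * (X * X) + 4 * X"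
  proof -
    define e1 e2 where "e1 = int (edge_count (lev c) (snd u) (snd v))" and "e2 = int (edge_count (lev c') (snd u) (snd v))"
    have "\<bar>fst u - fst v\<bar> + int (line_cost (lev c) (snd u) (snd v)) \<le> int (wdist u v)"
      using path_cost_lower_col[OF geod_path[OF p(1)], of 0 m "lev c"] geod_path_cost[OF p(1), of 0 m] p best_le[OF p(4)] by auto
    then have "Y + e1 \<le> int (wdist u v)" by (simp add: line_cost_def Y_def e1_def)
    also have "\<dots> \<le> int (wdist u (c', snd u)) + int (wdist (c', snd u) (c', snd v)) + int (wdist (c', snd v) v)"
      using wdist_triangle[of u v "(c', snd u)"] wdist_triangle[of "(c', snd u)" v "(c', snd v)"] by linarith
    also have "\<dots> \<le> 2 * X + (Y + e2) + 2 * X"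
    proof (intro add_mono)
      show "int (wdist u (c', snd u)) \<le> 2 * X" using wdist_le_twice[of u "(c', snd u)"] nu by simp
      show "int (wdist (c', snd v) v) \<le> 2 * X" using wdist_le_twice[of "(c', snd v)" v] nv by (simp add: abs_minus_commute)
      have "int (wdist (c', snd u) (c', snd v)) \<le> int (line_cost (lev c') (snd u) (snd v))"
        by (intro of_nat_mono wdist_col)
      then show "int (wdist (c', snd u) (c', snd v)) \<le> Y + e2" by (simp add: line_cost_def Y_def e2_def)
    qed
    finally have "e1 \<le> 4 * X + e2" by simp
    then have "X * e1 \<le> X * (4 * X + e2)" using X8 by (intro mult_left_mono) auto
    moreover have "X * (e2 - 2) \<le> Y" unfolding X_def Y_def e2_def by (rule edge_count_upper)
    moreover have "8 * Y \<le> X * (e1 + 2)"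
    proof -
      have "Y \<le> 2 ^ lev c * (e1 + 2)" unfolding Y_def e1_def by (rule edge_count_lower)
      then have "8 * Y \<le> (8 * 2 ^ lev c) * (e1 + 2)" by simp
      also have "\<dots> \<le> X * (e1 + 2)" using X8 by (intro mult_right_mono) (auto simp: e1_def)
      finally show ?thesis .
    qed
    ultimately show ?thesis by (simp add: algebra_simps)
  qed
  \<comment> \<open>The two bounds on \<open>Y\<close> combine to
    \<open>3 * (X * X) \<le> 18 * X\<close>, which is impossible for
    \<open>8 \<le> X\<close>.\<close>
  moreover have "8 * X \<le> X * X" using X8 by (intro mult_right_mono) auto
  ultimately show False using X8 by linarith
qed

lemma card_le_4_nat:
  fixes S :: "nat set"
  assumes "\<And>a b c. \<lbrakk>a \<in> S; b \<in> S; c \<in> S; a + 3 \<le> b; b < c\<rbrakk> \<Longrightarrow> False"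
  shows "finite S \<and> card S \<le> 4"
proof (cases "S = {}")
  case False
  define a where "a = (LEAST a. a \<in> S)"
  have a: "a \<in> S" "\<And>b. b \<in> S \<Longrightarrow> a \<le> b"
    unfolding a_def using False by (auto intro: LeastI Least_le)
  obtain b where b: "\<And>c. c \<in> S \<Longrightarrow> a + 3 \<le> c \<Longrightarrow> c = b"
    using assms[OF a(1)] by (metis linorder_neqE_nat)
  have "S \<subseteq> {a, a + 1, a + 2, b}"
  proof
    fix c assume "c \<in> S"
    then show "c \<in> {a, a + 1, a + 2, b}" using a(2)[of c] b[of c] by (cases "a + 3 \<le> c") auto
  qed
  moreover have "card {a, a + 1, a + 2, b} \<le> 4" using card_length[of "[a, a + 1, a + 2, b]"] by simp
  ultimately show ?thesis by (meson card_mono finite.emptyI finite_insert finite_subset order.trans)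
qed simp

text \<open>On each side of \<open>fst u\<close> the levels are distinct and lie among the lowest
  one, the next two values and one further value. That gives 4 columns per side, plus the column of
  \<open>u\<close> itself.\<close>

lemma best_cols_bound: "finite (best_cols u v)" "card (best_cols u v) \<le> 9"
proof -
  let ?B = "best_cols u v"
  have *: "finite A \<and> card A \<le> 4"
    if A: "A \<subseteq> ?B" "\<And>c c'. \<lbrakk>c \<in> A; c' \<in> A\<rbrakk> \<Longrightarrow> fst u < c \<and> fst u < c' \<or> c < fst u \<and> c' < fst u" for A
  proof -
    have inj: "inj_on lev A" using inj_on_subset[OF inj_on_best_cols A(1)] .
    have "finite (lev ` A) \<and> card (lev ` A) \<le> 4"
      by (rule card_le_4_nat) (use A three_best_cols in blast)
    then show ?thesis using inj by (simp add: finite_image_iff card_image)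
  qed
  have A: "finite {c \<in> ?B. fst u < c} \<and> card {c \<in> ?B. fst u < c} \<le> 4" by (rule *) auto
  have B: "finite {c \<in> ?B. c < fst u} \<and> card {c \<in> ?B. c < fst u} \<le> 4" by (rule *) auto
  have sub: "?B \<subseteq> insert (fst u) ({c \<in> ?B. fst u < c} \<union> {c \<in> ?B. c < fst u})" by auto
  show "finite ?B" using sub A B by (meson finite_UnI finite_insert finite_subset)
  have "card ?B \<le> card (insert (fst u) ({c \<in> ?B. fst u < c} \<union> {c \<in> ?B. c < fst u}))"
    using A B sub by (intro card_mono) auto
  also have "\<dots> \<le> Suc (card {c \<in> ?B. fst u < c} + card {c \<in> ?B. c < fst u})"
    using A B by (simp add: card_insert_if card_Un_le le_SucI)
  also have "\<dots> \<le> 9" using A B by simp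
  finally show "card ?B \<le> 9" .
qed

section \<open>Slices of the weighted grid\<close>

definition wslice :: "int \<times> int \<Rightarrow> int \<times> int \<Rightarrow> nat \<Rightarrow> (int \<times> int) set" where
  "wslice u v k = {w. wdist u w = k \<and> wdist u w + wdist w v = wdist u v}"

lemma card_le_1I:
  assumes "\<And>x y. \<lbrakk>x \<in> S; y \<in> S\<rbrakk> \<Longrightarrow> x = y"
  shows "finite S \<and> card S \<le> 1"
proof (cases "S = {}")
  case False
  then obtain x where "x \<in> S" by blast
  then have "S = {x}" using assms by blast
  then show ?thesis by simp
qed simp

lemma card_Un_le_add: "finite A \<and> card A \<le> a \<Longrightarrow> finite B \<and> card B \<le> b \<Longrightarrow> finite (A \<union> B) \<and> card (A \<union> B) \<le> a + b"
  by (meson add_mono card_Un_le finite_UnI order.trans)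

lemma card_UN_le_mult:
  assumes "finite I" "card I \<le> m" "\<And>i. i \<in> I \<Longrightarrow> finite (A i) \<and> card (A i) \<le> n"
  shows "finite (\<Union>i\<in>I. A i) \<and> card (\<Union>i\<in>I. A i) \<le> m * n"
proof
  show "finite (\<Union>i\<in>I. A i)" using assms by blast
  have "card (\<Union>i\<in>I. A i) \<le> (\<Sum>i\<in>I. card (A i))" using assms(1) by (rule card_UN_le)
  also have "\<dots> \<le> (\<Sum>i\<in>I. n)" using assms(3) by (intro sum_mono) simp
  also have "\<dots> \<le> m * n" using assms(2) by simp
  finally show "card (\<Union>i\<in>I. A i) \<le> m * n" .
qed

lemma card_subset_le: "finite B \<and> card B \<le> n \<Longrightarrow> A \<subseteq> B \<Longrightarrow> finite A \<and> card A \<le> n"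
  by (meson card_mono finite_subset order.trans)

lemma card_image_bound: "finite A \<and> card A \<le> n \<Longrightarrow> finite (f ` A) \<and> card (f ` A) \<le> n"
  by (meson card_image_le finite_imageI order.trans)

text \<open>The cost is strictly monotone on each side of \<open>r\<close>.\<close>

lemma card_line_cost_eq: "finite {y. line_cost l y r = n} \<and> card {y. line_cost l y r = n} \<le> 2"
proof -
  have strict: "line_cost l y' r < line_cost l y r" if "y < y'" "y' \<le> r \<or> r \<le> y'" "y' \<le> r" for y y'
    using edge_count_add[of y y' r l] that by (simp add: line_cost_def)
  have strict': "line_cost l y r < line_cost l y' r" if "y < y'" "r \<le> y" for y y'
    using edge_count_add[of r y y' l] that by (simp add: line_cost_def edge_count_commute)
  have "finite {y. line_cost l y r = n \<and> y \<le> r} \<and> card {y. line_cost l y r = n \<and> y \<le> r} \<le> 1"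
  proof (rule card_le_1I)
    fix y y' assume "y \<in> {y. line_cost l y r = n \<and> y \<le> r}" "y' \<in> {y. line_cost l y r = n \<and> y \<le> r}"
    then show "y = y'" using strict[of y y'] strict[of y' y] by (cases y y' rule: linorder_cases) auto
  qed
  moreover have "finite {y. line_cost l y r = n \<and> r \<le> y} \<and> card {y. line_cost l y r = n \<and> r \<le> y} \<le> 1"
  proof (rule card_le_1I)
    fix y y' assume "y \<in> {y. line_cost l y r = n \<and> r \<le> y}" "y' \<in> {y. line_cost l y r = n \<and> r \<le> y}"
    then show "y = y'" using strict'[of y y'] strict'[of y' y] by (cases y y' rule: linorder_cases) auto
  qed
  ultimately have "finite ({y. line_cost l y r = n \<and> y \<le> r} \<union> {y. line_cost l y r = n \<and> r \<le> y}) \<and>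
      card ({y. line_cost l y r = n \<and> y \<le> r} \<union> {y. line_cost l y r = n \<and> r \<le> y}) \<le> 1 + 1"
    by (rule card_Un_le_add)
  moreover have "{y. line_cost l y r = n} = {y. line_cost l y r = n \<and> y \<le> r} \<union> {y. line_cost l y r = n \<and> r \<le> y}" by auto
  ultimately show ?thesis by (simp only: one_add_one)
qed

text \<open>The factor 14 is \<open>2 * (1 + 6)\<close>: \<open>near_start\<close> bounds the two
  coordinate differences by 1 and 6 times \<open>2 ^ lev x\<close>, and
  \<open>wdist_le_twice\<close> doubles their sum.\<close>

definition near_lines :: "int \<Rightarrow> nat \<Rightarrow> int set" where
  "near_lines a k = {x. \<bar>a - x\<bar> \<le> int k \<and> int k \<le> 14 * 2 ^ lev x}"

lemma near_lines_bound: "finite (near_lines a k) \<and> card (near_lines a k) \<le> 29"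
proof -
  define l where "l = (LEAST l. k \<le> 14 * 2 ^ l)"
  have "\<exists>l. k \<le> 14 * 2 ^ l" using less_exp[of k] by (intro exI[of _ k]) linarith
  then have l: "k \<le> 14 * 2 ^ l" unfolding l_def by (rule LeastI_ex)
  have min: "l \<le> l'" if "k \<le> 14 * 2 ^ l'" for l' unfolding l_def using that by (rule Least_le)
  have "near_lines a k \<subseteq> {x \<in> {a - int k..<a + int k + 1}. l \<le> lev x}"
  proof
    fix x assume "x \<in> near_lines a k"
    then have x: "\<bar>a - x\<bar> \<le> int k" "int k \<le> 14 * 2 ^ lev x" by (auto simp: near_lines_def)
    have "int k \<le> int (14 * 2 ^ lev x)" using x(2) by simp
    then have "k \<le> 14 * 2 ^ lev x" by (simp only: of_nat_le_iff)
    then show "x \<in> {x \<in> {a - int k..<a + int k + 1}. l \<le> lev x}" using min x(1) by auto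
  qed
  moreover have "lev_count l (a - int k) (a + int k + 1) \<le> 29"
  proof (rule lev_count_le)
    \<comment> \<open>The interval has length \<open>2 * k + 1\<close>, at most
      \<open>28 * X + 1\<close> and hence at most \<open>29 * X\<close>.\<close>
    define X :: int where "X = 2 ^ l"
    have "int k \<le> int (14 * 2 ^ l)" using l by (simp only: of_nat_le_iff)
    then have "int k \<le> 14 * X" by (simp add: X_def)
    moreover have "1 \<le> X" by (simp add: X_def)
    ultimately show "a + int k + 1 \<le> a - int k + int 29 * 2 ^ l" unfolding X_def[symmetric] by simp
  qed
  ultimately show ?thesis
    unfolding lev_count_def by (rule card_subset_le[OF conjI[OF finite_Collect_interval], rotated])
qed

text \<open>The intervals from \<open>y\<close> to \<open>\<sigma> y\<close> are pairwise disjoint,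
  so \<open>\<sigma>\<close> is injective below the maximum of \<open>Y\<close>. Nothing is known
  about where the interval of the maximum ends, hence \<open>Suc n\<close>.\<close>

lemma chain_card:
  fixes Y :: "int set"
  assumes "finite Y" "finite F \<and> card F \<le> n"
    and "\<And>y. y \<in> Y \<Longrightarrow> y < \<sigma> y"
    and chain: "\<And>y y'. \<lbrakk>y \<in> Y; y' \<in> Y; y < y'\<rbrakk> \<Longrightarrow> \<sigma> y < y' \<and> \<sigma> y \<in> F"
  shows "card Y \<le> Suc n"
proof (cases "Y = {}")
  case False
  let ?M = "Max Y"
  have M: "?M \<in> Y" "\<And>y. y \<in> Y \<Longrightarrow> y \<le> ?M" using assms(1) False by auto
  have "inj_on \<sigma> (Y - {?M})"
  proof (rule inj_onI)
    fix y y' assume yy: "y \<in> Y - {?M}" "y' \<in> Y - {?M}" "\<sigma> y = \<sigma> y'"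
    then show "y = y'"
      using chain[of y y'] chain[of y' y] assms(3)[of y] assms(3)[of y']
      by (cases y y' rule: linorder_cases) auto
  qed
  moreover have "\<sigma> ` (Y - {?M}) \<subseteq> F"
  proof
    fix z assume "z \<in> \<sigma> ` (Y - {?M})"
    then obtain y where y: "y \<in> Y" "y \<noteq> ?M" "z = \<sigma> y" by auto
    then have "y < ?M" using M(2)[of y] by simp
    then show "z \<in> F" using chain[OF y(1) M(1)] y(3) by simp
  qed
  ultimately have "card (Y - {?M}) \<le> card F" using assms(2) by (intro card_inj_on_le[of \<sigma>]) auto
  moreover have "card (Y - {?M}) = card Y - 1" using M(1) by simp
  ultimately show ?thesis using assms(2) by linarith
qed simp

lemma geod_wdist_pos: "\<lbrakk>geod p m; i < j; j \<le> m\<rbrakk> \<Longrightarrow> 0 < wdist (p i) (p j)"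
proof -
  assume g: "geod p m" and ij: "i < j" "j \<le> m"
  have "gadj (p i) (p (Suc i))" using path_gadj[OF geod_path[OF g]] ij by simp
  then have "0 < wdist (p i) (p (Suc i))" using wdist_ge[of "p i" "p (Suc i)"] by (simp add: gadj_def)
  then show ?thesis using geod_wdist_add[OF g, of i "Suc i" j] ij by simp
qed

section \<open>Vertices of a slice before the crossing and off the best column\<close>

abbreviation best_rows :: "int \<times> int \<Rightarrow> int \<times> int \<Rightarrow> int set" where
  "best_rows u v \<equiv> best_cols (prod.swap u) (prod.swap v)"

text \<open>The demand for a vertical step makes \<open>unimodal_col\<close> applicable; vertices
  that are left horizontally are covered by exchanging the coordinates.\<close>

definition climb :: "int \<times> int \<Rightarrow> int \<times> int \<Rightarrow> nat \<Rightarrow> (int \<times> int) set" where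
  "climb u v k = {w. \<exists>p m t s c r. geod p m \<and> p 0 = u \<and> p m = v \<and> p t = w \<and> wdist u w = k \<and>
     t < s \<and> s \<le> m \<and> p s = (c, r) \<and> best (\<lambda>i. fst (p i)) 0 m c \<and> best (\<lambda>i. snd (p i)) 0 m r \<and>
     fst w \<noteq> c \<and> fst (p t) = fst (p (Suc t))}"

lemma near_line:
  assumes g: "geod p m" and t: "t < s" "s \<le> m" and s: "fst (p s) = c" and c: "best (\<lambda>i. fst (p i)) 0 m c"
    and "fst (p t) \<noteq> c" and V: "fst (p t) = fst (p (Suc t))"
  shows "int (wdist (p 0) (p t)) \<le> 14 * 2 ^ lev (fst (p t))"
proof -
  have after: "lev (fst (p t)) < lev (fst (p s))" using best_less[OF c, of t] assms by simp
  \<comment> \<open>A better column before time \<open>t\<close> would, together with the one at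
    time \<open>s\<close>, put the vertical step into a valley.\<close>
  have before: "lev (fst (p i)) \<le> lev (fst (p t))" if "i \<le> t" for i
    using unimodal_col[OF g that _ t(2) V _ after] t by force
  have "\<bar>fst (p 0) - fst (p t)\<bar> < 2 ^ lev (fst (p t))" "\<bar>snd (p 0) - snd (p t)\<bar> \<le> 6 * 2 ^ lev (fst (p t))"
    using near_start[OF g _ t(2) before after] t by auto
  then have "2 * (\<bar>fst (p 0) - fst (p t)\<bar> + \<bar>snd (p 0) - snd (p t)\<bar>)
      \<le> 2 * (2 ^ lev (fst (p t)) + 6 * 2 ^ lev (fst (p t)))"
    by (intro mult_left_mono add_mono) auto
  then show ?thesis using wdist_le_twice[of "p 0" "p t"] by simp
qed

lemma climb_col: "w \<in> climb u v k \<Longrightarrow> fst w \<in> near_lines (fst u) k"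
proof -
  assume "w \<in> climb u v k"
  then obtain p m t s c r where p: "geod p m" "p 0 = u" "p t = w" "wdist u w = k" "t < s" "s \<le> m" "p s = (c, r)"
    "best (\<lambda>i. fst (p i)) 0 m c" "fst w \<noteq> c" "fst (p t) = fst (p (Suc t))"
    unfolding climb_def by blast
  then have "int k \<le> 14 * 2 ^ lev (fst w)" using near_line[OF p(1,5,6) _ p(8)] by auto
  then show ?thesis using wdist_ge[of u w] p(4) by (simp add: near_lines_def)
qed

text \<open>The run on column \<open>x\<close> ends by turning onto row \<open>z\<close>; since it passes the vertices between \<open>y\<close> and \<open>z\<close> after
  time \<open>k\<close>, distinct vertices of the slice on this column have separated runs.\<close>

lemma climb_run_end:
  assumes "(x, y) \<in> climb u v k"
  shows "\<exists>z. z \<noteq> y \<and> (\<forall>y'. y' \<noteq> y \<longrightarrow> min y z \<le> y' \<longrightarrow> y' \<le> max y z \<longrightarrow> k < wdist u (x, y')) \<and>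
     (z \<in> best_rows u v \<or> int k \<le> 14 * 2 ^ lev z)"
proof -
  obtain p m t s c r where p: "geod p m" "p 0 = u" "p m = v" "p t = (x, y)" "wdist u (x, y) = k" "t < s" "s \<le> m"
    "p s = (c, r)" "best (\<lambda>i. fst (p i)) 0 m c" "best (\<lambda>i. snd (p i)) 0 m r" "x \<noteq> c" "fst (p t) = fst (p (Suc t))"
    using assms unfolding climb_def by auto
  note pa = geod_path[OF p(1)]
  \<comment> \<open>The first element \<open>e\<close> of \<open>J\<close> is the time at which the
    run on column \<open>x\<close> ends. It exists because column \<open>c\<close>, different from
    \<open>x\<close>, is reached by time \<open>s\<close>.\<close>
  define J where "J = {j \<in> {t..<s}. fst (p (Suc j)) \<noteq> x}"
  have "finite J" by (simp add: J_def)
  have run: "fst (p j) = x" if "t \<le> j" "\<And>i. t \<le> i \<Longrightarrow> i < j \<Longrightarrow> fst (p (Suc i)) = x" for j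
    using that p(4) by (cases j) (auto simp: le_Suc_eq)
  have "J \<noteq> {}"
  proof
    assume "J = {}"
    then have "fst (p (Suc j)) = x" if "t \<le> j" "j < s" for j
      using that unfolding J_def by (metis (mono_tags, lifting) atLeastLessThan_iff empty_iff mem_Collect_eq)
    then have "fst (p s) = x" using p(6) by (intro run[of s]) auto
    then show False using p(8,11) by simp
  qed
  define e where "e = Min J"
  have "e \<in> J" unfolding e_def using \<open>finite J\<close> \<open>J \<noteq> {}\<close> by (rule Min_in)
  then have e: "t \<le> e" "e < s" "fst (p (Suc e)) \<noteq> x" by (auto simp: J_def)
  have min: "fst (p (Suc j)) = x" if "t \<le> j" "j < e" for j
  proof (rule ccontr)
    assume "\<not> ?thesis"
    then have "j \<in> J" using that e by (simp add: J_def)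
    then show False using Min_le[OF \<open>finite J\<close>, of j] that by (simp add: e_def)
  qed
  have col: "fst (p j) = x" if "t \<le> j" "j \<le> e" for j
    using that by (intro run[of j] min) auto
  have te: "t < e" using e p by (metis fst_conv le_neq_implies_less)
  define z where "z = snd (p e)"
  have "p t \<noteq> p e" using geod_wdist_pos[OF p(1) te] e p by (metis wdist_refl less_imp_le order.trans less_irrefl)
  then have zy: "z \<noteq> y" using col[of e] e p by (auto simp: z_def prod_eq_iff)
  have far: "k < wdist u (x, y')" if y': "y' \<noteq> y" "min y z \<le> y'" "y' \<le> max y z" for y'
  proof -
    obtain i where i: "t \<le> i" "i \<le> e" "snd (p i) = y'"
      using visit_row[OF pa, of t e y'] e p y' by (auto simp: z_def)
    then have pi: "p i = (x, y')" using col by (simp add: prod_eq_iff)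
    then have "t < i" using i y' p by (cases "t = i") auto
    then have "wdist u (p t) + wdist (p t) (p i) = wdist u (p i)" "0 < wdist (p t) (p i)"
      using geod_wdist_add[OF p(1), of 0 t i] geod_wdist_pos[OF p(1), of t i] i e p by auto
    then show ?thesis using pi p by simp
  qed
  have H: "snd (p e) = snd (p (Suc e))"
    using path_gadj[OF pa, of e] e p col[of e] by (auto elim: gadj_cases)
  \<comment> \<open>The step at time \<open>e\<close> is horizontal. So unless \<open>z\<close> is
    the best row, \<open>near_line\<close> with exchanged coordinates bounds the distance of
    \<open>p e\<close> from \<open>u\<close>, which is at least \<open>k\<close>.\<close>
  have "z \<in> best_rows u v \<or> int k \<le> 14 * 2 ^ lev z"
  proof (cases "z = r")
    case True
    then show ?thesis using geod_swap[OF p(1)] p unfolding best_cols_def by (auto intro!: exI[of _ "prod.swap \<circ> p"] exI[of _ m])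
  next
    case False
    have "int (wdist u (p e)) \<le> 14 * 2 ^ lev z"
      using near_line[OF geod_swap[OF p(1)] e(2) p(7), of r] p False H wdist_swap[of u "p e"] by (simp add: z_def)
    moreover have "wdist u (p e) = wdist u (p t) + wdist (p t) (p e)" using geod_wdist_add[OF p(1), of 0 t e] e p by simp
    ultimately show ?thesis using p by simp
  qed
  then show ?thesis using zy far by blast
qed

text \<open>Runs in the same direction are disjoint. Each of them except the outermost therefore
  ends between two vertices of the slice, within \<open>k\<close> of \<open>snd u\<close>, and so on
  one of at most 29 near rows or 9 best rows. This gives at most 39 upward and 39 downward
  runs.\<close>

lemma climb_column_bound:
  "finite {y. (x, y) \<in> climb u v k} \<and> card {y. (x, y) \<in> climb u v k} \<le> 78"
proof -
  let ?Y = "{y. (x, y) \<in> climb u v k}"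
  have Dk: "wdist u (x, y) = k" if "y \<in> ?Y" for y using that by (auto simp: climb_def)
  have near: "\<bar>snd u - y\<bar> \<le> int k" if "y \<in> ?Y" for y using wdist_ge[of u "(x, y)"] Dk[OF that] by simp
  have "?Y \<subseteq> {snd u - int k..snd u + int k}" 
  proof
    fix y assume "y \<in> ?Y"
    from near[OF this] show "y \<in> {snd u - int k..snd u + int k}" by (simp add: abs_le_iff)
  qed
  then have fin: "finite ?Y" by (rule finite_subset) simp
  obtain \<sigma> where \<sigma>: "\<And>y. y \<in> ?Y \<Longrightarrow> \<sigma> y \<noteq> y"
    "\<And>y y'. \<lbrakk>y \<in> ?Y; y' \<noteq> y; min y (\<sigma> y) \<le> y'; y' \<le> max y (\<sigma> y)\<rbrakk> \<Longrightarrow> k < wdist u (x, y')"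
    "\<And>y. y \<in> ?Y \<Longrightarrow> \<sigma> y \<in> best_rows u v \<or> int k \<le> 14 * 2 ^ lev (\<sigma> y)"
    using climb_run_end[of x _ u v k] by (metis (no_types, lifting) mem_Collect_eq)
  define F where "F = near_lines (snd u) k \<union> best_rows u v"
  have F: "finite F \<and> card F \<le> 29 + 9"
    unfolding F_def by (intro card_Un_le_add near_lines_bound conjI best_cols_bound)
  have sep: "\<not> (min y (\<sigma> y) \<le> y' \<and> y' \<le> max y (\<sigma> y))" if "y \<in> ?Y" "y' \<in> ?Y" "y' \<noteq> y" for y y'
    using \<sigma>(2)[OF that(1,3)] Dk[OF that(2)] by auto
  have inF: "\<sigma> y \<in> F" if "y \<in> ?Y" "\<bar>snd u - \<sigma> y\<bar> \<le> int k" for y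
    using \<sigma>(3)[OF that(1)] that(2) by (auto simp: F_def near_lines_def)
  have "card {y \<in> ?Y. y < \<sigma> y} \<le> Suc (29 + 9)"
  proof (rule chain_card[OF _ F])
    fix y y' assume y: "y \<in> {y \<in> ?Y. y < \<sigma> y}" "y' \<in> {y \<in> ?Y. y < \<sigma> y}" "y < y'"
    then have "\<sigma> y < y'" using sep[of y y'] by auto
    then show "\<sigma> y < y' \<and> \<sigma> y \<in> F" using y near[of y] near[of y'] by (intro conjI inF) auto
  qed (use fin in auto)
  moreover have "card (uminus ` {y \<in> ?Y. \<sigma> y < y}) \<le> Suc (29 + 9)"
  proof (rule chain_card[OF _ card_image_bound[OF F, of uminus]])
    fix y y' assume "y \<in> uminus ` {y \<in> ?Y. \<sigma> y < y}" "y' \<in> uminus ` {y \<in> ?Y. \<sigma> y < y}" "y < y'"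
    then have y: "- y \<in> ?Y" "\<sigma> (- y) < - y" "- y' \<in> ?Y" "- y' < - y" by auto
    then have "- y' < \<sigma> (- y)" using sep[of "- y" "- y'"] by auto
    moreover from this have "\<sigma> (- y) \<in> F" using y near[of "- y"] near[of "- y'"] by (intro inF) auto
    ultimately show "- \<sigma> (- y) < y' \<and> - \<sigma> (- y) \<in> uminus ` F" by auto
  qed (use fin in auto)
  then have "card {y \<in> ?Y. \<sigma> y < y} \<le> Suc (29 + 9)" by (simp add: card_image)
  moreover have "?Y \<subseteq> {y \<in> ?Y. y < \<sigma> y} \<union> {y \<in> ?Y. \<sigma> y < y}" using \<sigma>(1) by force
  then have "card ?Y \<le> card {y \<in> ?Y. y < \<sigma> y} + card {y \<in> ?Y. \<sigma> y < y}"
    using fin by (intro order.trans[OF card_mono card_Un_le]) auto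
  ultimately show ?thesis using fin by simp
qed

lemma climb_bound: "finite (climb u v k) \<and> card (climb u v k) \<le> 29 * 78"
proof (rule card_subset_le)
  show "climb u v k \<subseteq> (\<Union>x\<in>near_lines (fst u) k. Pair x ` {y. (x, y) \<in> climb u v k})"
  proof
    fix w assume "w \<in> climb u v k"
    then show "w \<in> (\<Union>x\<in>near_lines (fst u) k. Pair x ` {y. (x, y) \<in> climb u v k})"
      using climb_col[of w u v k] by (intro UN_I[of "fst w"] image_eqI[of _ _ "snd w"]) auto
  qed
  show "finite (\<Union>x\<in>near_lines (fst u) k. Pair x ` {y. (x, y) \<in> climb u v k}) \<and>
    card (\<Union>x\<in>near_lines (fst u) k. Pair x ` {y. (x, y) \<in> climb u v k}) \<le> 29 * 78"
    using near_lines_bound by (intro card_UN_le_mult card_image_bound climb_column_bound) auto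
qed

text \<open>On the best column the cost that remains up to the crossing \<open>(c, r)\<close>
  determines the vertex, up to the choice of a side of \<open>r\<close>.\<close>

definition on_best_col :: "int \<times> int \<Rightarrow> int \<times> int \<Rightarrow> nat \<Rightarrow> (int \<times> int) set" where
  "on_best_col u v k = (\<Union>c\<in>best_cols u v. \<Union>r\<in>best_rows u v. Pair c ` {y. line_cost (lev c) y r = wdist u (c, r) - k})"

lemma on_best_col_bound: "finite (on_best_col u v k) \<and> card (on_best_col u v k) \<le> 9 * (9 * 2)"
  unfolding on_best_col_def by (intro card_UN_le_mult card_image_bound card_line_cost_eq best_cols_bound)

lemma on_best_colI:
  assumes g: "geod p m" and t: "t \<le> s" "s \<le> m" and s: "p s = (c, r)"
    and c: "best (\<lambda>i. fst (p i)) 0 m c" and r: "best (\<lambda>i. snd (p i)) 0 m r" and "fst (p t) = c"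
  shows "p t \<in> on_best_col (p 0) (p m) (wdist (p 0) (p t))"
proof -
  have "wdist (p t) (p s) \<le> line_cost (lev c) (snd (p t)) r"
    using wdist_col[of c "snd (p t)" r] assms by (metis prod.collapse)
  moreover have "\<bar>fst (p t) - fst (p s)\<bar> + int (line_cost (lev c) (snd (p t)) (snd (p s))) \<le> int (path_cost p t s)"
    using t best_le[OF c] by (intro path_cost_lower_col[OF geod_path[OF g]]) auto
  moreover have "path_cost p t s = wdist (p t) (p s)" using geod_path_cost[OF g t] .
  moreover have "wdist (p 0) (p t) + wdist (p t) (p s) = wdist (p 0) (p s)" using geod_wdist_add[OF g, of 0 t s] t by simp
  ultimately have "line_cost (lev c) (snd (p t)) r = wdist (p 0) (c, r) - wdist (p 0) (p t)" using s assms(7) by simp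
  moreover have "c \<in> best_cols (p 0) (p m)" using g c by (auto simp: best_cols_def)
  moreover have "r \<in> best_rows (p 0) (p m)" using geod_swap[OF g] r
    unfolding best_cols_def by (auto intro!: exI[of _ "prod.swap \<circ> p"] exI[of _ m])
  moreover have "p t = (c, snd (p t))" using assms(7) by (simp add: prod_eq_iff)
  ultimately show ?thesis unfolding on_best_col_def by blast
qed

section \<open>All vertices of a slice of the weighted grid\<close>

definition before_crossing :: "int \<times> int \<Rightarrow> int \<times> int \<Rightarrow> nat \<Rightarrow> (int \<times> int) set" where
  "before_crossing u v k = (on_best_col u v k \<union> climb u v k) \<union>
     prod.swap ` (on_best_col (prod.swap u) (prod.swap v) k \<union> climb (prod.swap u) (prod.swap v) k)"

lemma before_crossing_bound: "finite (before_crossing u v k) \<and> card (before_crossing u v k) \<le> (9 * (9 * 2) + 29 * 78) + (9 * (9 * 2) + 29 * 78)"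
  unfolding before_crossing_def by (intro card_Un_le_add card_image_bound on_best_col_bound climb_bound)

lemma before_crossingI:
  assumes g: "geod p m" and t: "t \<le> s" "s \<le> m" and s: "p s = (c, r)"
    and c: "best (\<lambda>i. fst (p i)) 0 m c" and r: "best (\<lambda>i. snd (p i)) 0 m r"
  shows "p t \<in> before_crossing (p 0) (p m) (wdist (p 0) (p t))"
proof -
  let ?q = "prod.swap \<circ> p"
  note g' = geod_swap[OF g]
  have q: "p t = prod.swap (?q t)" "wdist (p 0) (p t) = wdist (?q 0) (?q t)" by (simp_all add: wdist_swap)
  consider "fst (p t) = c" | "snd (p t) = r" | "fst (p t) \<noteq> c" "snd (p t) \<noteq> r" by blast
  then show ?thesis
  proof cases
    case 1
    then show ?thesis using on_best_colI[OF g t s c r] by (simp add: before_crossing_def)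
  next
    case 2
    then have "?q t \<in> on_best_col (?q 0) (?q m) (wdist (?q 0) (?q t))"
      using s c r by (intro on_best_colI[OF g' t]) auto
    then show ?thesis unfolding before_crossing_def q by (simp add: wdist_swap) force
  next
    case 3
    then have "t < s" using s t by (cases "t = s") auto
    then have "gadj (p t) (p (Suc t))" using path_gadj[OF geod_path[OF g]] t by simp
    then show ?thesis
    proof (cases rule: gadj_cases)
      case V
      then have "p t \<in> climb (p 0) (p m) (wdist (p 0) (p t))"
        unfolding climb_def using g \<open>t < s\<close> t s c r 3
        by (intro CollectI exI[of _ p] exI[of _ m] exI[of _ t] exI[of _ s] exI[of _ c] exI[of _ r]) auto
      then show ?thesis by (simp add: before_crossing_def)
    next
      case H
      then have "?q t \<in> climb (?q 0) (?q m) (wdist (?q 0) (?q t))"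
        unfolding climb_def using g' \<open>t < s\<close> t s c r 3
        by (intro CollectI exI[of _ ?q] exI[of _ m] exI[of _ t] exI[of _ s] exI[of _ r] exI[of _ c]) auto
      then show ?thesis unfolding before_crossing_def q by (simp add: wdist_swap) force
    qed
  qed
qed

lemma best_rev: "best f 0 m c \<Longrightarrow> best (\<lambda>i. f (m - i)) 0 m c"
  unfolding best_def by (metis diff_diff_cancel diff_le_self le0)

text \<open>Vertices after the crossing lie before it on the reversed geodesic, at distance
  \<open>wdist u v - k\<close> from \<open>v\<close>.\<close>

lemma wslice_bound: "\<exists>C. \<forall>u v k. finite (wslice u v k) \<and> card (wslice u v k) \<le> C"
proof -
  have sub: "wslice u v k \<subseteq> before_crossing u v k \<union> before_crossing v u (wdist u v - k)" for u v k
  proof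
    fix w assume "w \<in> wslice u v k"
    then have w: "wdist u w = k" "wdist u w + wdist w v = wdist u v" by (auto simp: wslice_def)
    from ex_geod_through[OF w(2)] obtain p m t where
      p: "geod p m" "p 0 = u" "p m = v" "t \<le> m" "p t = w" by blast
    obtain c r where c: "best (\<lambda>i. fst (p i)) 0 m c" and r: "best (\<lambda>i. snd (p i)) 0 m r"
      using ex_best_col[OF geod_path[OF p(1)], of 0 m] ex_best_row[OF geod_path[OF p(1)], of 0 m] by auto
    obtain s where s: "s \<le> m" "p s = (c, r)" using corner[OF p(1) _ _ c r] by auto
    show "w \<in> before_crossing u v k \<union> before_crossing v u (wdist u v - k)"
    proof (cases "t \<le> s")
      case True
      then show ?thesis using before_crossingI[OF p(1) True s c r] p w by simp
    next
      case False
      have "p (m - (m - t)) \<in> before_crossing (p (m - 0)) (p (m - m)) (wdist (p (m - 0)) (p (m - (m - t))))"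
        using False s p by (intro before_crossingI[OF geod_rev[OF p(1)], of "m - t" "m - s" c r] best_rev[OF c] best_rev[OF r]) auto
      moreover have "wdist v w = wdist u v - k" using w wdist_commute[of v w] by linarith
      ultimately show ?thesis using p by simp
    qed
  qed
  let ?C = "(9 * (9 * 2) + 29 * 78) + (9 * (9 * 2) + 29 * 78) :: nat"
  have "finite (wslice u v k) \<and> card (wslice u v k) \<le> ?C + ?C" for u v k
    by (rule card_subset_le[OF card_Un_le_add[OF before_crossing_bound before_crossing_bound] sub])
  then show ?thesis by blast
qed

section \<open>Distances as numbers of steps\<close>

lemma awalk_relpow: "pre_digraph.awalk (with_proj X) u p v \<Longrightarrow> (u, v) \<in> parcs X ^^ length p"
proof -
  have "\<lbrakk>set p \<subseteq> parcs X; pre_digraph.cas (with_proj X) u p v\<rbrakk> \<Longrightarrow> (u, v) \<in> parcs X ^^ length p"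
  proof (induction p arbitrary: u)
    case (Cons e p)
    then have "(u, snd e) \<in> parcs X" "(snd e, v) \<in> parcs X ^^ length p"
      by (auto simp: pre_digraph.cas.simps)
    then have "(u, v) \<in> parcs X ^^ Suc (length p)" by (rule relpow_Suc_I2)
    then show ?case by simp
  qed (auto simp: pre_digraph.cas.simps)
  then show "pre_digraph.awalk (with_proj X) u p v \<Longrightarrow> (u, v) \<in> parcs X ^^ length p"
    by (auto simp: pre_digraph.awalk_def)
qed

lemma relpow_awalk:
  assumes "pverts X = UNIV"
  shows "(u, v) \<in> parcs X ^^ n \<Longrightarrow> \<exists>p. pre_digraph.awalk (with_proj X) u p v \<and> length p = n"
proof (induction n arbitrary: u)
  case 0
  then show ?case using assms by (intro exI[of _ "[]"]) (simp add: pre_digraph.awalk_def pre_digraph.cas.simps)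
next
  case (Suc n)
  from relpow_Suc_D2[OF Suc.prems] obtain w where w: "(u, w) \<in> parcs X" "(w, v) \<in> parcs X ^^ n" by blast
  from Suc.IH[OF w(2)] obtain p where "pre_digraph.awalk (with_proj X) w p v" "length p = n" by blast
  then show ?case using w(1) assms
    by (intro exI[of _ "(u, w) # p"]) (simp add: pre_digraph.awalk_def pre_digraph.cas.simps)
qed

text \<open>Relational powers replace walks as lists of arcs; concatenation becomes
  \<open>relpow_add\<close>.\<close>

definition hops :: "'a rel \<Rightarrow> 'a \<Rightarrow> 'a \<Rightarrow> nat" where
  "hops R u v = (LEAST n. (u, v) \<in> R ^^ n)"

lemma hops_le: "(u, v) \<in> R ^^ n \<Longrightarrow> hops R u v \<le> n"
  unfolding hops_def by (rule Least_le)

lemma relpow_hops: "(u, v) \<in> R\<^sup>* \<Longrightarrow> (u, v) \<in> R ^^ hops R u v"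
  unfolding hops_def by (metis LeastI_ex rtrancl_imp_relpow)

locale full_graph =
  fixes X :: "'a pair_pre_digraph"
  assumes wf: "wf_digraph (with_proj X)" and verts: "pverts X = UNIV"
    and reach: "(u, v) \<in> (parcs X)\<^sup>*"
begin

abbreviation "hop \<equiv> hops (parcs X)"

lemma relpow_hop: "(u, v) \<in> parcs X ^^ hop u v"
  using relpow_hops[OF reach] .

lemma hop_triangle: "hop u w \<le> hop u v + hop v w"
  by (intro hops_le) (metis relpow_add relcompI relpow_hop)

lemma graph_dist_eq: "graph_dist X u v = ereal (real (hop u v))"
proof -
  interpret W: wf_digraph "with_proj X" by (rule wf)
  have len: "W.awalk_cost (\<lambda>_. 1) p = real (length p)" for p by (induction p) simp_all
  obtain p where p: "W.awalk u p v" "length p = hop u v"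
    using relpow_awalk[OF verts relpow_hop] by blast
  have "W.\<mu> (\<lambda>_. 1) u v \<le> ereal (real (hop u v))"
    using W.min_cost_le_walk_cost[OF p(1), of "\<lambda>_. 1"] by (simp add: len p(2))
  moreover have "ereal (real (hop u v)) \<le> W.\<mu> (\<lambda>_. 1) u v"
    unfolding W.\<mu>_def by (intro INF_greatest) (auto simp: len intro!: hops_le awalk_relpow)
  ultimately show ?thesis unfolding graph_dist_def by (rule order.antisym)
qed

lemma geodesic_slice_hop:
  assumes "w \<in> geodesic_slice X u v k"
  shows "int (hop u w) = k" "hop u w + hop w v = hop u v"
proof -
  interpret W: wf_digraph "with_proj X" by (rule wf)
  have len: "W.awalk_cost (\<lambda>_. 1) p = real (length p)" for p by (induction p) simp_all
  obtain p where p: "geodesic X u p v" "w \<in> set (W.awalk_verts u p)"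
    and k: "graph_dist X u w = ereal (real_of_int k)"
    using assms unfolding geodesic_slice_def by blast
  show "int (hop u w) = k" using k by (simp add: graph_dist_eq)
  obtain q where q: "W.awalk u q v" "length q = hop u v"
    using relpow_awalk[OF verts relpow_hop] by blast
  \<comment> \<open>A geodesic is compared only with walks without repeated vertices, so the
    shortest walk \<open>q\<close> is first reduced to such a walk, which cannot make it
    longer.\<close>
  have "length p \<le> length (W.awalk_to_apath q)"
    using p(1) W.apath_awalk_to_apath[OF q(1)] unfolding geodesic_def by blast
  also have "W.awalk_cost (\<lambda>_. 1) (W.awalk_to_apath q) \<le> W.awalk_cost (\<lambda>_. 1) q"
    by (rule W.awalk_to_path_no_neg_cyc_cost[OF q(1)]) (auto simp: len)
  then have "length (W.awalk_to_apath q) \<le> hop u v" by (simp add: len q(2))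
  finally have "length p \<le> hop u v" .
  moreover have "W.awalk u p v" using p(1) by (simp add: geodesic_def W.apath_def)
  from W.awalk_decomp[OF this p(2)] obtain q r where "p = q @ r" "W.awalk u q w" "W.awalk w r v" by blast
  then have "hop u w + hop w v \<le> length p"
    using hops_le[OF awalk_relpow, of X u q w] hops_le[OF awalk_relpow, of X w r v] by simp
  ultimately show "hop u w + hop w v = hop u v" using hop_triangle[of u v w] by simp
qed

text \<open>Shortest walks from \<open>u\<close> to \<open>w\<close> and from \<open>w\<close> to
  \<open>v\<close> are joined. As the total length is minimal, every segment is a shortest walk
  too.\<close>

lemma ex_hop_path:
  assumes "hop u w + hop w v = hop u v"
  obtains h where "h 0 = u" "h (hop u w) = w" "h (hop u v) = v"
    "\<And>i. i < hop u v \<Longrightarrow> (h i, h (Suc i)) \<in> parcs X"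
    "\<And>i j. i \<le> j \<Longrightarrow> j \<le> hop u v \<Longrightarrow> (h i, h j) \<in> parcs X ^^ (j - i) \<and> hop (h i) (h j) = j - i"
proof -
  define t N where "t = hop u w" and "N = hop u v"
  have N: "N = t + hop w v" using assms by (simp add: t_def N_def)
  obtain f where f: "f 0 = u" "f t = w" "\<And>i. i < t \<Longrightarrow> (f i, f (Suc i)) \<in> parcs X"
    using relpow_hop[of u w] unfolding relpow_fun_conv t_def by blast
  obtain g where g: "g 0 = w" "g (hop w v) = v" "\<And>i. i < hop w v \<Longrightarrow> (g i, g (Suc i)) \<in> parcs X"
    using relpow_hop[of w v] unfolding relpow_fun_conv by blast
  define h where "h i = (if i \<le> t then f i else g (i - t))" for i
  have hg: "h i = g (i - t)" if "t \<le> i" for i using that f g by (cases "i = t") (auto simp: h_def)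
  have h: "h 0 = u" "h t = w" "h N = v" using f g N hg[of N] by (auto simp: h_def)
  have step: "(h i, h (Suc i)) \<in> parcs X" if "i < N" for i
  proof (cases "i < t")
    case True
    then show ?thesis using f(3)[of i] by (simp add: h_def)
  next
    case False
    then show ?thesis using g(3)[of "i - t"] that N by (simp add: hg Suc_diff_le)
  qed
  have pow: "(h i, h j) \<in> parcs X ^^ (j - i)" if "i \<le> j" "j \<le> N" for i j
    unfolding relpow_fun_conv
    by (rule exI[of _ "\<lambda>k. h (i + k)"]) (use that step in auto)
  have "hop (h i) (h j) = j - i" if ij: "i \<le> j" "j \<le> N" for i j
  proof -
    have "N \<le> hop (h 0) (h i) + (hop (h i) (h j) + hop (h j) (h N))"
      using hop_triangle[of "h 0" "h N" "h i"] hop_triangle[of "h i" "h N" "h j"] h by (simp add: N_def)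
    moreover have "hop (h 0) (h i) \<le> i" "hop (h i) (h j) \<le> j - i" "hop (h j) (h N) \<le> N - j"
      using hops_le[OF pow[of 0 i]] hops_le[OF pow[of i j]] hops_le[OF pow[of j N]] ij by auto
    ultimately show ?thesis using ij by linarith
  qed
  then show ?thesis using h step pow by (intro that[of h]) (auto simp: t_def N_def)
qed

end

section \<open>The extension of the square lattice\<close>

definition l1 :: "int \<times> int \<Rightarrow> int \<times> int \<Rightarrow> int" where
  "l1 p q = \<bar>fst p - fst q\<bar> + \<bar>snd p - snd q\<bar>"

lemma l1_triangle: "l1 p r \<le> l1 p q + l1 q r"
  unfolding l1_def by linarith

lemma l1_commute: "l1 p q = l1 q p"
  by (simp add: l1_def abs_minus_commute)

lemma gadj_l1: "gadj p q \<longleftrightarrow> l1 p q = 1"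
  by (simp add: gadj_def l1_def)

definition dbl :: "int \<times> int \<Rightarrow> int \<times> int" where
  "dbl p = (2 * fst p, 2 * snd p)"

definition jump :: "int \<times> int \<Rightarrow> int \<times> int \<Rightarrow> bool" where
  "jump P Q \<longleftrightarrow> (\<exists>a b. gadj a b \<and> edge_weight a b = 1 \<and> P = dbl a \<and> Q = dbl b)"

definition highway :: "(int \<times> int) pair_pre_digraph" where
  "highway = \<lparr>pverts = UNIV, parcs = {(P, Q). gadj P Q \<or> jump P Q}\<rparr>"

lemma l1_dbl: "l1 (dbl a) (dbl b) = 2 * l1 a b"
proof -
  have "\<bar>2 * x - 2 * y\<bar> = 2 * \<bar>x - y\<bar>" for x y :: int by (simp add: abs_if)
  then show ?thesis by (simp add: l1_def dbl_def)
qed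

lemma highway_arcs: "(P, Q) \<in> parcs highway \<longleftrightarrow> gadj P Q \<or> jump P Q"
  by (simp add: highway_def)

lemma highway_l1: "(P, Q) \<in> parcs highway \<Longrightarrow> 1 \<le> l1 P Q \<and> l1 P Q \<le> 2"
  by (auto simp: highway_arcs jump_def l1_dbl gadj_l1)

lemma highway_verts: "pverts highway = UNIV"
  by (simp add: highway_def)

lemma highway_irrefl: "(P, P) \<notin> parcs highway"
  using highway_l1[of P P] by (auto simp: l1_def)

lemma highway_sym: "(P, Q) \<in> parcs highway \<Longrightarrow> (Q, P) \<in> parcs highway"
  unfolding highway_arcs jump_def by (metis gadj_commute edge_weight_commute)

lemma unit_relpow: "(P, Q) \<in> {(P, Q). gadj P Q} ^^ nat (l1 P Q)"
proof -
  have "(P, Q) \<in> {(P, Q). gadj P Q} ^^ n" if "l1 P Q = int n" for n P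
    using that
  proof (induction n arbitrary: P)
    case 0
    then show ?case by (auto simp: l1_def prod_eq_iff)
  next
    case (Suc n)
    have "\<exists>P'. gadj P P' \<and> l1 P' Q = int n"
    proof (cases "fst P = fst Q")
      case True
      then show ?thesis using Suc.prems
        by (intro exI[of _ "(fst P, snd P + (if snd P < snd Q then 1 else -1))"]) (auto simp: gadj_def l1_def)
    next
      case False
      then show ?thesis using Suc.prems
        by (intro exI[of _ "(fst P + (if fst P < fst Q then 1 else -1), snd P)"]) (auto simp: gadj_def l1_def)
    qed
    then obtain P' where P': "gadj P P'" "l1 P' Q = int n" by blast
    then have "(P, P') \<in> {(P, Q). gadj P Q}" by simp
    from relpow_Suc_I2[OF this Suc.IH[OF P'(2)]] show ?case .
  qed
  moreover have "0 \<le> l1 P Q" by (simp add: l1_def)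
  ultimately show ?thesis by simp
qed

lemma unit_highway: "(P, Q) \<in> parcs highway ^^ nat (l1 P Q)"
proof -
  have "(P, Q) \<in> {(P, Q). gadj P Q} ^^ n \<Longrightarrow> (P, Q) \<in> parcs highway ^^ n" for n
  proof (induction n arbitrary: Q)
    case (Suc n)
    then obtain R where "(P, R) \<in> parcs highway ^^ n" "(R, Q) \<in> parcs highway"
      by (auto simp: highway_arcs)
    then show ?case by (rule relpow_Suc_I)
  qed simp
  then show ?thesis using unit_relpow by blast
qed

lemma wf_highway: "wf_digraph (with_proj highway)"
  by unfold_locales (auto simp: highway_def)

interpretation highway: full_graph highway
proof (rule full_graph.intro[OF wf_highway])
  show "pverts highway = UNIV" by (simp add: highway_def)
  show "(u, v) \<in> (parcs highway)\<^sup>*" for u v using unit_highway by (rule relpow_imp_rtrancl)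
qed

lemma connected_graph_highway: "connected_graph highway"
proof -
  interpret pair_bidirected_digraph highway
    by unfold_locales (auto simp: highway_verts highway_irrefl symmetric_def sym_def dest: highway_sym)
  have "u \<rightarrow>\<^sup>*\<^bsub>with_proj highway\<^esub> v" for u v
    using highway.reach[of u v] by (simp add: reachable_conv) (simp add: highway_def)
  then have "Digraph_Component.connected (with_proj highway)"
    by (intro connectedI reachable_mk_symmetricI) (simp_all add: highway_def)
  then show ?thesis by unfold_locales
qed

lemma bounded_extension_highway: "bounded_extension highway square_lattice"
  unfolding bounded_extension_def
proof (intro conjI exI ballI)
  have gadj: "parcs square_lattice = {(P, Q). gadj P Q}"
    by (auto simp: square_lattice_def gadj_def)
  have wfl: "wf_digraph (with_proj square_lattice)" by unfold_locales (auto simp: square_lattice_def)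
  interpret lattice: full_graph square_lattice
  proof (rule full_graph.intro[OF wfl])
    show "pverts square_lattice = UNIV" by (simp add: square_lattice_def)
    show "(u, v) \<in> (parcs square_lattice)\<^sup>*" for u v
      using unit_relpow[of u v] unfolding gadj by (rule relpow_imp_rtrancl)
  qed
  show "spanning (with_proj square_lattice) (with_proj highway)"
    unfolding spanning_def subgraph_def using wfl wf_highway
    by (auto simp: gadj highway_arcs compatible_def square_lattice_def[THEN arg_cong[of _ _ pverts]] highway_def)
  fix e assume "e \<in> parcs highway"
  then obtain P Q where e: "e = (P, Q)" "(P, Q) \<in> parcs highway" by (cases e) auto
  have "hops (parcs square_lattice) P Q \<le> nat (l1 P Q)" unfolding gadj by (intro hops_le unit_relpow)
  then have "hops (parcs square_lattice) P Q \<le> 2" using highway_l1[OF e(2)] by linarith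
  then show "case e of (u, v) \<Rightarrow> graph_dist square_lattice u v \<le> ereal (real 2)"
    by (simp add: e lattice.graph_dist_eq)
qed

section \<open>Distances between even points\<close>

lemma edge_weight_le_2: "gadj a b \<Longrightarrow> edge_weight a b = 1 \<or> edge_weight a b = 2"
proof -
  assume adj: "gadj a b"
  have "1 \<le> line_cost l x y \<and> line_cost l x y \<le> 2" if "\<bar>x - y\<bar> = 1" for l x y
  proof -
    have "1 \<le> int (line_cost l x y)" "int (line_cost l x y) \<le> 2"
      using line_cost_ge[of x y l] line_cost_le[of l x y] that by simp_all
    then show ?thesis by simp
  qed
  with adj have "1 \<le> edge_weight a b \<and> edge_weight a b \<le> 2"
    by (cases rule: gadj_cases) (auto simp: edge_weight_H edge_weight_V[OF adj])
  then show ?thesis by linarith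
qed

lemma wwalk_highway: "wwalk a n b \<Longrightarrow> (dbl a, dbl b) \<in> parcs highway ^^ n"
proof (induction rule: wwalk.induct)
  case (step n b c)
  have "(dbl b, dbl c) \<in> parcs highway ^^ edge_weight b c"
    using edge_weight_le_2[OF step.hyps(2)]
  proof
    assume "edge_weight b c = 1"
    then have "jump (dbl b) (dbl c)" using step.hyps(2) unfolding jump_def by blast
    then show ?thesis using \<open>edge_weight b c = 1\<close> by (simp add: highway_arcs)
  next
    assume "edge_weight b c = 2"
    then show ?thesis using unit_highway[of "dbl b" "dbl c"] step.hyps(2) by (simp add: l1_dbl gadj_l1)
  qed
  then show ?case using step.IH by (auto simp: relpow_add)
qed simp

text \<open>During unit steps \<open>b\<close> is kept and the \<open>l1\<close> term pays. At a
  jump from \<open>dbl a'\<close> the term \<open>l1 (dbl a') (dbl b)\<close> is exchanged for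
  \<open>wdist b a'\<close>, which is no larger: a doubled edge has length 2 and no weight exceeds
  2. So unit steps through other points give no shortcut.\<close>

lemma highway_potential:
  "(dbl a, P) \<in> parcs highway ^^ n \<Longrightarrow> \<exists>b. int (wdist a b) + l1 P (dbl b) \<le> int n"
proof (induction n arbitrary: P)
  case 0
  then show ?case by (intro exI[of _ a]) (auto simp: l1_def)
next
  case (Suc n)
  then obtain P' where P': "(dbl a, P') \<in> parcs highway ^^ n" "(P', P) \<in> parcs highway" by auto
  from Suc.IH[OF P'(1)] obtain b where b: "int (wdist a b) + l1 P' (dbl b) \<le> int n" by blast
  from P'(2) consider "gadj P' P" | "jump P' P" by (auto simp: highway_arcs)
  then show ?case
  proof cases
    case 1
    then show ?thesis using b l1_triangle[of P "dbl b" P'] by (intro exI[of _ b]) (simp add: gadj_l1 l1_commute)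
  next
    case 2
    then obtain a' b' where ab: "gadj a' b'" "edge_weight a' b' = 1" "P' = dbl a'" "P = dbl b'" by (auto simp: jump_def)
    have "int (wdist b a') \<le> 2 * l1 a' b" using wdist_le_twice[of a' b] by (simp add: l1_def wdist_commute)
    then have "int (wdist a a') \<le> int n" using b wdist_triangle[of a a' b] by (simp add: ab l1_dbl)
    moreover have "wdist a' b' \<le> 1"
      using wdist_le[OF wwalk.step[OF wwalk.refl ab(1)]] ab(2) by simp
    ultimately show ?thesis
      using wdist_triangle[of a b' a'] by (intro exI[of _ b']) (simp add: ab l1_def)
  qed
qed

lemma hops_dbl: "hops (parcs highway) (dbl a) (dbl b) = wdist a b"
proof (rule order.antisym)
  show "hops (parcs highway) (dbl a) (dbl b) \<le> wdist a b"
    by (intro hops_le wwalk_highway wwalk_wdist)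
  obtain c where c: "int (wdist a c) + l1 (dbl b) (dbl c) \<le> int (hops (parcs highway) (dbl a) (dbl b))"
    using highway_potential[OF highway.relpow_hop] by blast
  have "int (wdist c b) \<le> l1 (dbl b) (dbl c)"
    unfolding wdist_commute[of c b] l1_dbl unfolding l1_def by (rule wdist_le_twice)
  then show "wdist a b \<le> hops (parcs highway) (dbl a) (dbl b)" using c wdist_triangle[of a b c] by linarith
qed

text \<open>On a line of level at least 1 only about every second edge is charged, and there are
  such a row and column within distance 1 of \<open>a\<close> and \<open>b\<close>. The constant is
  8 for reaching and leaving these lines plus 7 for each of the two legs.\<close>

lemma wdist_le_three_halves: "2 * int (wdist a b) \<le> 3 * l1 a b + 22"
proof -
  obtain x y x' y' where ab: "a = (x, y)" "b = (x', y')" by fastforce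
  obtain r where r: "y \<le> r" "r < y + 2" "1 \<le> lev r" using ex_lev_ge[of y 1] by auto
  obtain c where c: "x' \<le> c" "c < x' + 2" "1 \<le> lev c" using ex_lev_ge[of x' 1] by auto
  have seg1: "2 * int (line_cost (lev z) p q) \<le> 3 * \<bar>p - q\<bar> + 4" if "1 \<le> lev z" for z p q
  proof -
    have "2 * (int (edge_count 1 p q) - 2) \<le> \<bar>p - q\<bar>" using edge_count_upper[of 1 p q] by simp
    moreover have "line_cost (lev z) p q \<le> line_cost 1 p q" using that by (rule line_cost_antimono)
    ultimately show ?thesis by (simp add: line_cost_def)
  qed
  have "int (wdist a b) \<le> int (wdist (x, y) (x, r)) + int (wdist (x, r) (c, r)) + int (wdist (c, r) (c, y')) + int (wdist (c, y') (x', y'))"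
    using wdist_triangle[of "(x, y)" "(x', y')" "(x, r)"] wdist_triangle[of "(x, r)" "(x', y')" "(c, r)"]
      wdist_triangle[of "(c, r)" "(x', y')" "(c, y')"] unfolding ab by linarith
  moreover have "int (wdist (x, y) (x, r)) \<le> 2" "int (wdist (c, y') (x', y')) \<le> 2"
    using wdist_le_twice[of "(x, y)" "(x, r)"] wdist_le_twice[of "(c, y')" "(x', y')"] r c by auto
  moreover have "2 * int (wdist (x, r) (c, r)) \<le> 3 * \<bar>x - c\<bar> + 4"
    using wdist_row[of x r c] seg1[OF r(3), of x c] by linarith
  moreover have "2 * int (wdist (c, r) (c, y')) \<le> 3 * \<bar>r - y'\<bar> + 4"
    using wdist_col[of c r y'] seg1[OF c(3), of r y'] by linarith
  moreover have "\<bar>x - c\<bar> \<le> \<bar>x - x'\<bar> + 1" "\<bar>r - y'\<bar> \<le> \<bar>y - y'\<bar> + 1" using r c by linarith+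
  ultimately show ?thesis unfolding ab l1_def by simp
qed

section \<open>From even points to all points of the extension\<close>

definition half_pt :: "int \<times> int \<Rightarrow> int \<times> int" where
  "half_pt P = (fst P div 2, snd P div 2)"

lemma half_pt_dbl [simp]: "half_pt (dbl a) = a"
  by (simp add: half_pt_def dbl_def)

lemma l1_half_pt: "l1 P (dbl (half_pt P)) \<le> 2"
  unfolding l1_def half_pt_def dbl_def by simp

text \<open>A walk avoiding the even points moves by unit steps only, and hence too slowly to stay geodesic.\<close>

lemma geodesic_meets_even:
  assumes step: "\<And>i. i < N \<Longrightarrow> (h i, h (Suc i)) \<in> parcs highway"
    and geo: "\<And>i j. i \<le> j \<Longrightarrow> j \<le> N \<Longrightarrow> hops (parcs highway) (h i) (h j) = j - i"
    and i: "i + 73 \<le> N"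
  shows "\<exists>j a. i \<le> j \<and> j \<le> i + 73 \<and> h j = dbl a"
proof (rule ccontr)
  assume none: "\<not> ?thesis"
  have "l1 (h i) (h (i + n)) \<le> int n" if "n \<le> 73" for n
    using that
  proof (induction n)
    case (Suc n)
    have "\<not> jump (h (i + n)) (h (i + Suc n))" using none Suc.prems by (auto simp: jump_def)
    then have "l1 (h (i + n)) (h (i + Suc n)) = 1"
      using step[of "i + n"] i Suc.prems by (simp add: highway_arcs gadj_l1)
    then show ?case using Suc l1_triangle[of "h i" "h (i + Suc n)" "h (i + n)"] by simp
  qed (simp add: l1_def)
  then have l: "l1 (h i) (h (i + 73)) \<le> 73" by fastforce
  define P Q where "P = h i" and "Q = h (i + 73)"
  define a b where "a = half_pt P" and "b = half_pt Q"
  have "73 = hops (parcs highway) P Q" using geo[of i "i + 73"] i by (simp add: P_def Q_def)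
  also have "\<dots> \<le> hops (parcs highway) P (dbl a) + (wdist a b + hops (parcs highway) (dbl b) Q)"
    using highway.hop_triangle[of P Q "dbl a"] highway.hop_triangle[of "dbl a" Q "dbl b"] hops_dbl[of a b] by linarith
  finally have "73 \<le> int (hops (parcs highway) P (dbl a)) + int (wdist a b) + int (hops (parcs highway) (dbl b) Q)"
    by linarith
  moreover have "hops (parcs highway) P (dbl a) \<le> nat (l1 P (dbl a))"
    "hops (parcs highway) (dbl b) Q \<le> nat (l1 (dbl b) Q)" by (intro hops_le unit_highway)+
  moreover have "l1 P (dbl a) \<le> 2" "l1 Q (dbl b) \<le> 2" unfolding a_def b_def by (rule l1_half_pt)+
  moreover have "2 * l1 a b \<le> l1 P (dbl a) + l1 P Q + l1 Q (dbl b)"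
    using l1_triangle[of "dbl a" "dbl b" P] l1_triangle[of P "dbl b" Q] by (simp add: l1_dbl l1_commute)
  \<comment> \<open>For \<open>n\<close> unit steps in place of 73 these estimates bound the number
    of hops by \<open>4 + (3 * (n + 4) / 2 + 22) / 2\<close>, that is, by
    \<open>3 * n / 4 + 18\<close>. This is less than \<open>n\<close> from \<open>n = 73\<close>
    on.\<close>
  ultimately show False
    using wdist_le_three_halves[of a b] l by (simp add: P_def[symmetric] Q_def[symmetric] l1_commute)
qed

lemma highway_relpow_l1: "(P, Q) \<in> parcs highway ^^ n \<Longrightarrow> l1 P Q \<le> 2 * int n"
proof (induction n arbitrary: Q)
  case (Suc n)
  then obtain R where R: "(P, R) \<in> parcs highway ^^ n" "(R, Q) \<in> parcs highway" by auto
  then show ?case using Suc.IH[OF R(1)] highway_l1[OF R(2)] l1_triangle[of P Q R] by simp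
qed (auto simp: l1_def)

definition l1_ball :: "int \<times> int \<Rightarrow> nat \<Rightarrow> (int \<times> int) set" where
  "l1_ball P n = {Q. l1 P Q \<le> int n}"

lemma l1_ball_bound: "finite (l1_ball P n) \<and> card (l1_ball P n) \<le> (2 * n + 1) * (2 * n + 1)"
proof (rule card_subset_le)
  let ?B = "{fst P - int n..fst P + int n} \<times> {snd P - int n..snd P + int n}"
  have "nat (2 * int n + 1) = 2 * n + 1" by linarith
  then show "finite ?B \<and> card ?B \<le> (2 * n + 1) * (2 * n + 1)" by (simp add: card_cartesian_product)
  show "l1_ball P n \<subseteq> ?B"
  proof
    fix Q assume "Q \<in> l1_ball P n"
    then have "\<bar>fst P - fst Q\<bar> \<le> int n" "\<bar>snd P - snd Q\<bar> \<le> int n" by (auto simp: l1_ball_def l1_def)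
    then show "Q \<in> ?B" by (cases Q) auto
  qed
qed

lemma bounded_geodesic_slices_highway: "bounded_geodesic_slices highway"
proof -
  obtain C where C: "\<And>u v k. finite (wslice u v k) \<and> card (wslice u v k) \<le> C"
    using wslice_bound by blast
  define b1 b2 :: nat where "b1 = (2 * 146 + 1) * (2 * 146 + 1)" and "b2 = (2 * 292 + 1) * (2 * 292 + 1)"
  \<comment> \<open>An arc has \<open>l1\<close> length at most 2, so 73 steps stay within 146 and
    146 steps within 292. Replacing \<open>u\<close>, \<open>w\<close> and \<open>v\<close> by even
    points on the same geodesic changes the index of the slice by at most 73.\<close>
  define S where "S u v k = (l1_ball u 292 \<union> l1_ball v 292) \<union>
    (\<Union>P\<in>l1_ball u 146. \<Union>Q\<in>l1_ball v 146. \<Union>n\<in>{k - 73..k + 73}.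
       \<Union>b\<in>wslice (half_pt P) (half_pt Q) n. l1_ball (dbl b) 146)" for u v and k :: nat
  have S: "finite (S u v k) \<and> card (S u v k) \<le> (b2 + b2) + b1 * (b1 * (147 * (C * b1)))" for u v k
  proof -
    have b1: "finite (l1_ball P 146) \<and> card (l1_ball P 146) \<le> b1" for P
      unfolding b1_def by (rule l1_ball_bound)
    have b2: "finite (l1_ball P 292) \<and> card (l1_ball P 292) \<le> b2" for P
      unfolding b2_def by (rule l1_ball_bound)
    have k: "finite {k - 73..k + 73}" "card {k - 73..k + 73} \<le> 147" by auto
    show ?thesis
      unfolding S_def
      by (intro card_Un_le_add card_UN_le_mult b1 b2 k b1[THEN conjunct1] b1[THEN conjunct2]
          C[THEN conjunct1] C[THEN conjunct2])
  qed
  have sub: "geodesic_slice highway u v k \<subseteq> S u v (nat k)" for u v k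
  proof
    fix w assume "w \<in> geodesic_slice highway u v k"
    note hop = highway.geodesic_slice_hop[OF this]
    from highway.ex_hop_path[OF hop(2)] obtain h where h: "h 0 = u" "h (highway.hop u w) = w" "h (highway.hop u v) = v"
      and step: "\<And>i. i < highway.hop u v \<Longrightarrow> (h i, h (Suc i)) \<in> parcs highway"
      and pow: "\<And>i j. i \<le> j \<Longrightarrow> j \<le> highway.hop u v \<Longrightarrow> (h i, h j) \<in> parcs highway ^^ (j - i) \<and> highway.hop (h i) (h j) = j - i"
      by blast
    define t N where "t = highway.hop u w" and "N = highway.hop u v"
    note h = h[folded t_def N_def] and step = step[folded N_def] and pow = pow[folded N_def]
    have tN: "t \<le> N" "nat k = t" using hop by (auto simp: t_def N_def)
    have l: "l1 (h i) (h j) \<le> 2 * int (j - i)" if "i \<le> j" "j \<le> N" for i j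
      using highway_relpow_l1 pow[OF that] by blast
    note even = geodesic_meets_even[of N h, OF step pow[THEN conjunct2]]
    consider "t \<le> 146" | "N \<le> t + 146" | "146 < t" "t + 146 < N" by linarith
    then show "w \<in> S u v (nat k)"
    proof cases
      case 1
      then have "w \<in> l1_ball u 292" using l[of 0 t] tN h by (simp add: l1_ball_def)
      then show ?thesis by (simp add: S_def)
    next
      case 2
      then have "w \<in> l1_ball v 292" using l[of t N] tN h by (simp add: l1_ball_def l1_commute)
      then show ?thesis by (simp add: S_def)
    next
      case 3
      \<comment> \<open>Both margins of 146 are twice the gap 73, which forces the order
        \<open>i < s < j\<close> of the three even points. Distances between them agree with
        \<open>wdist\<close> by \<open>hops_dbl\<close>, so \<open>b\<close> lies in a slice between
        \<open>a\<close> and \<open>e\<close>.\<close>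
      obtain i a where i: "i \<le> 73" "h i = dbl a" using even[of 0] 3 by auto
      obtain s b where s: "t \<le> s" "s \<le> t + 73" "h s = dbl b" using even[of t] 3 by auto
      obtain j e where j: "N - 73 \<le> j" "j \<le> N" "h j = dbl e" using even[of "N - 73"] 3 by auto
      have "wdist a b = s - i" "wdist b e = j - s" "wdist a e = j - i"
        using pow[of i s] pow[of s j] pow[of i j] i s j 3 hops_dbl by auto
      then have b: "b \<in> wslice a e (s - i)" using i s j 3 by (simp add: wslice_def)
      have P: "dbl a \<in> l1_ball u 146" using l[of 0 i] i h 3 by (simp add: l1_ball_def)
      have Q: "dbl e \<in> l1_ball v 146" using l[of j N] j h 3 by (simp add: l1_ball_def l1_commute)
      have w: "w \<in> l1_ball (dbl b) 146" using l[of t s] s h 3 by (simp add: l1_ball_def l1_commute)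
      have n: "s - i \<in> {nat k - 73..nat k + 73}" using i s 3 tN by auto
      have "w \<in> (\<Union>P\<in>l1_ball u 146. \<Union>Q\<in>l1_ball v 146. \<Union>n\<in>{nat k - 73..nat k + 73}.
         \<Union>b\<in>wslice (half_pt P) (half_pt Q) n. l1_ball (dbl b) 146)"
        by (intro UN_I[OF P] UN_I[OF Q] UN_I[OF n] UN_I[of b]) (simp_all add: b w)
      then show ?thesis unfolding S_def by (rule UnI2)
    qed
  qed
  show ?thesis
    unfolding bounded_geodesic_slices_def using card_subset_le[OF S sub] by blast
qed

theorem theorem1p8:
  shows "geodesically_directable square_lattice"
  unfolding geodesically_directable_def
  using connected_graph_highway bounded_extension_highway bounded_geodesic_slices_highway by blast

end
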